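(* Let $2\le n\le p<\infty$ ($n$ an integer), let $\mathcal{A}:\mathbf{R}^n\times\mathbf{R}^n\to\mathbf{R}^n$ satisfy the assumptions (A1)--(A3) of the context with weight $1$, let $w(\xi)=|\xi|^{2(p-n)}$, and let $\Omega\subset\mathbf{R}^n\setminus\{0\}$ be an unbounded open set. Let $T$ be the circular inversion and $\mathcal{B}$ the transformed map defined in the context. Then a point $x_0\in\widehat{\partial}\Omega$ is $\mathcal{A}$-regular with respect to $\Omega$ (weight $1$) if and only if the corresponding point $T(x_0)\in\widehat{\partial}T(\Omega)$ is $\mathcal{B}$-regular with respect to $T(\Omega)$ (weight $w$).
   Context: Inversion: $T(x)=x/|x|^2$ for $x\in\mathbf{R}^n\setminus\{0\}$, $T(0)=\boldsymbol{\infty}$, $T(\boldsymbol{\infty})=0$. $dT(x)$ is the Jacobian matrix of $T$ at $x\ne0$ and $J_T(x)$ its determinant. The map $\mathcal{B}:\mathbf{R}^n\times\mathbf{R}^n\to\mathbf{R}^n$ is $\mathcal{B}(\xi,q)=|J_T(x)|^{-1}dT(x)\mathcal{A}(x,dT(x)q)$ with $x=T(\xi)$ if $\xi\ne0$, and $\mathcal{B}(0,q)=0$. Conditions for a map $\mathcal{C}:\mathbf{R}^n\times\mathbf{R}^n\to\mathbf{R}^n$ with weight $\omega$: (A1) $\mathcal{C}(\cdot,q)$ is measurable for all $q$. (A2) $\mathcal{C}(x,\cdot)$ is continuous for a.e. $x$. (A3) There are $\alpha_2\ge\alpha_1>0$ such that for a.e. $x$, all $\lambda\in\mathbf{R}\setminus\{0\}$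 and all $q\ne q'$ in $\mathbf{R}^n$: $\mathcal{C}(x,q)\cdot q\ge\alpha_1\omega(x)|q|^p$; $|\mathcal{C}(x,q)|\le\alpha_2\omega(x)|q|^{p-1}$; $\mathcal{C}(x,\lambda q)=\lambda|\lambda|^{p-2}\mathcal{C}(x,q)$; $(\mathcal{C}(x,q)-\mathcal{C}(x,q'))\cdot(q-q')>0$. The map $\mathcal{B}$ satisfies these with weight $w$. In the following, $(\mathcal{C},\omega,V)$ is either $(\mathcal{A},1,\Omega)$ or $(\mathcal{B},w,T(\Omega))$. $G\Subset V$ means $\overline{G}$ is a compact subset of $V$; $C_0^\infty(V)=\{u\in C^\infty(\mathbf{R}^n):\operatorname{supp}u\Subset V\}$. $H^{1,p}(V,\omega)$ consists of the $u\in L^p(V,\omega)$ (the $L^p$-space for $\omega\,dx$) for which there are $v\in L^p(V,\omega)$ and $\varphi_j\in C^\infty(V)$ with $\varphi_j\to u$ and $\nabla\varphi_j\to v$ in $L^p(V,\omega)$; $v$ is unique and denoted $\nabla u$. $H^{1,p}_{\mathrm{loc}}(V,\omega)$ consists of the $u\in L^p_{\mathrm{loc}}(V,\omega)$ with $u|_G\in H^{1,p}(G,\omega)$ for every open $G\Subset V$. A function $u\in H^{1,p}_{\mathrm{loc}}(V,\omega)\cap C(V)$ is $\mathcal{C}$-harmonic if $\int_V\mathcal{C}(x,\nabla u)\cdot\nabla\varphi\,dx=0$ for all $\varphi\in C_0^\infty(V)$. A function $u:V\to(-\infty,\infty]$ is $\mathcal{C}$-superharmonic if it is lower semicontinuous,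 $u\not\equiv\infty$ in each component of $V$, and for each open $G\Subset V$ and all $v\in C(\overline{G})$ that are $\mathcal{C}$-harmonic in $G$, $v\le u$ on $\partial G$ implies $v\le u$ in $G$. Extended boundary: $\widehat{\partial}V=\partial V\cup\{\boldsymbol{\infty}\}$ if $V$ is unbounded and $\widehat{\partial}V=\partial V$ otherwise ($\partial V$ taken in $\mathbf{R}^n$), with topology inherited from the one-point compactification of $\mathbf{R}^n$. For $f\in C(\widehat{\partial}V)$, $\overline{P}f$ is the pointwise infimum over all $\mathcal{C}$-superharmonic $u$ in $V$ with $\liminf_{V\ni x\to z}u(x)\ge f(z)$ for all $z\in\widehat{\partial}V$. A point $x_0\in\widehat{\partial}V$ is $\mathcal{C}$-regular with respect to $V$ if $\lim_{V\ni x\to x_0}\overline{P}f(x)=f(x_0)$ for all $f\in C(\widehat{\partial}V)$. *)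

theory Defs
  imports "HOL-Analysis.Analysis"
begin

section \<open>Function spaces\<close>

definition compactly_contained :: "'a::topological_space set \<Rightarrow> 'a set \<Rightarrow> bool" where
  "compactly_contained G V \<longleftrightarrow> compact (closure G) \<and> closure G \<subseteq> V"

text \<open>For open \<open>S\<close>, \<open>Ck_on k S f\<close> is membership in \<open>C\<^sup>k(S)\<close>: all directional derivatives are
  again \<open>C\<^sup>k\<^sup>-\<^sup>1\<close>.\<close>

primrec Ck_on :: "nat \<Rightarrow> 'a::real_normed_vector set \<Rightarrow> ('a \<Rightarrow> 'b::real_normed_vector) \<Rightarrow> bool" where
  "Ck_on 0 S f \<longleftrightarrow> continuous_on S f"
| "Ck_on (Suc k) S f \<longleftrightarrow>
     (\<forall>x\<in>S. f differentiable (at x)) \<and> (\<forall>v. Ck_on k S (\<lambda>x. frechet_derivative f (at x) v))"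

definition smooth_fun_on :: "'a::real_normed_vector set \<Rightarrow> ('a \<Rightarrow> 'b::real_normed_vector) \<Rightarrow> bool" where
  "smooth_fun_on S f \<longleftrightarrow> (\<forall>k. Ck_on k S f)"

definition test_functions :: "'a::real_normed_vector set \<Rightarrow> ('a \<Rightarrow> real) set" where
  "test_functions V =
     {\<phi>. smooth_fun_on UNIV \<phi> \<and> compactly_contained {x. \<phi> x \<noteq> 0} V}"

definition gradient :: "(real^'n \<Rightarrow> real) \<Rightarrow> real^'n \<Rightarrow> real^'n" where
  "gradient \<phi> x = (\<chi> i. frechet_derivative \<phi> (at x) (axis i 1))"

text \<open>\<open>L\<^sup>p(V,\<omega>)\<close> and its norm. Elements are represented by functions on the whole space whose
  values outside \<open>V\<close> are irrelevant.\<close>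

definition Lp :: "real \<Rightarrow> ('a::euclidean_space \<Rightarrow> real) \<Rightarrow> 'a set \<Rightarrow> ('a \<Rightarrow> 'b::euclidean_space) set" where
  "Lp p \<omega> V = {u. set_borel_measurable lebesgue V u \<and>
                   set_integrable lebesgue V (\<lambda>x. norm (u x) powr p * \<omega> x)}"

definition Lp_norm :: "real \<Rightarrow> ('a::euclidean_space \<Rightarrow> real) \<Rightarrow> 'a set \<Rightarrow> ('a \<Rightarrow> 'b::euclidean_space) \<Rightarrow> real" where
  "Lp_norm p \<omega> V u = (LINT x:V|lebesgue. norm (u x) powr p * \<omega> x) powr (1 / p)"

definition Lp_converges ::
    "real \<Rightarrow> ('a::euclidean_space \<Rightarrow> real) \<Rightarrow> 'a set \<Rightarrow> (nat \<Rightarrow> 'a \<Rightarrow> 'b::euclidean_space) \<Rightarrow> ('a \<Rightarrow> 'b) \<Rightarrow> bool" where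
  "Lp_converges p \<omega> V f u \<longleftrightarrow>
     (\<forall>j. (\<lambda>x. f j x - u x) \<in> Lp p \<omega> V) \<and>
     (\<lambda>j. Lp_norm p \<omega> V (\<lambda>x. f j x - u x)) \<longlonglongrightarrow> 0"

definition Lp_loc :: "real \<Rightarrow> ('a::euclidean_space \<Rightarrow> real) \<Rightarrow> 'a set \<Rightarrow> ('a \<Rightarrow> 'b::euclidean_space) set" where
  "Lp_loc p \<omega> V = {u. \<forall>G. open G \<and> compactly_contained G V \<longrightarrow> u \<in> Lp p \<omega> G}"

text \<open>\<open>u \<in> H\<^sup>1\<^sup>,\<^sup>p(V,\<omega>)\<close> with \<open>\<nabla>u = v\<close>.\<close>

definition has_Sobolev_gradient ::
    "real \<Rightarrow> (real^'n \<Rightarrow> real) \<Rightarrow> (real^'n) set \<Rightarrow> (real^'n \<Rightarrow> real) \<Rightarrow> (real^'n \<Rightarrow> real^'n) \<Rightarrow> bool" where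
  "has_Sobolev_gradient p \<omega> V u v \<longleftrightarrow>
     u \<in> Lp p \<omega> V \<and> v \<in> Lp p \<omega> V \<and>
     (\<exists>\<phi>. (\<forall>j. smooth_fun_on V (\<phi> j)) \<and>
          Lp_converges p \<omega> V \<phi> u \<and> Lp_converges p \<omega> V (\<lambda>j. gradient (\<phi> j)) v)"

definition H1p :: "real \<Rightarrow> (real^'n \<Rightarrow> real) \<Rightarrow> (real^'n) set \<Rightarrow> (real^'n \<Rightarrow> real) set" where
  "H1p p \<omega> V = {u. \<exists>v. has_Sobolev_gradient p \<omega> V u v}"

definition H1p_loc :: "real \<Rightarrow> (real^'n \<Rightarrow> real) \<Rightarrow> (real^'n) set \<Rightarrow> (real^'n \<Rightarrow> real) set" where
  "H1p_loc p \<omega> V =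
     {u \<in> Lp_loc p \<omega> V. \<forall>G. open G \<and> compactly_contained G V \<longrightarrow> u \<in> H1p p \<omega> G}"

definition has_local_Sobolev_gradient ::
    "real \<Rightarrow> (real^'n \<Rightarrow> real) \<Rightarrow> (real^'n) set \<Rightarrow> (real^'n \<Rightarrow> real) \<Rightarrow> (real^'n \<Rightarrow> real^'n) \<Rightarrow> bool" where
  "has_local_Sobolev_gradient p \<omega> V u v \<longleftrightarrow>
     (\<forall>G. open G \<and> compactly_contained G V \<longrightarrow> has_Sobolev_gradient p \<omega> G u v)"


section \<open>Harmonic and superharmonic functions\<close>

text \<open>The structural conditions (A1), (A2), (A3) on a map \<open>C\<close> with weight \<open>\<omega>\<close>.\<close>

definition admissible_map ::
    "real \<Rightarrow> (real^'n \<Rightarrow> real) \<Rightarrow> (real^'n \<Rightarrow> real^'n \<Rightarrow> real^'n) \<Rightarrow> bool" where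
  "admissible_map p \<omega> C \<longleftrightarrow>
     (\<forall>q. (\<lambda>x. C x q) \<in> borel_measurable lebesgue) \<and>
     (AE x in lebesgue. continuous_on UNIV (C x)) \<and>
     (\<exists>\<alpha>\<^sub>1 \<alpha>\<^sub>2. 0 < \<alpha>\<^sub>1 \<and> \<alpha>\<^sub>1 \<le> \<alpha>\<^sub>2 \<and>
        (AE x in lebesgue.
           (\<forall>q. C x q \<bullet> q \<ge> \<alpha>\<^sub>1 * \<omega> x * norm q powr p) \<and>
           (\<forall>q. norm (C x q) \<le> \<alpha>\<^sub>2 * \<omega> x * norm q powr (p - 1)) \<and>
           (\<forall>t q. t \<noteq> 0 \<longrightarrow> C x (t *\<^sub>R q) = (t * \<bar>t\<bar> powr (p - 2)) *\<^sub>R C x q) \<and>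
           (\<forall>q q'. q \<noteq> q' \<longrightarrow> (C x q - C x q') \<bullet> (q - q') > 0)))"

text \<open>The Sobolev gradient is determined up to null sets, so it is quantified existentially.
  Integrability is stated explicitly because the Bochner integral of a non-integrable function
  is \<open>0\<close>.\<close>

definition C_harmonic ::
    "real \<Rightarrow> (real^'n \<Rightarrow> real) \<Rightarrow> (real^'n \<Rightarrow> real^'n \<Rightarrow> real^'n) \<Rightarrow> (real^'n) set \<Rightarrow> (real^'n \<Rightarrow> real) \<Rightarrow> bool" where
  "C_harmonic p \<omega> C V u \<longleftrightarrow>
     u \<in> H1p_loc p \<omega> V \<and> continuous_on V u \<and>
     (\<exists>v. has_local_Sobolev_gradient p \<omega> V u v \<and>
        (\<forall>\<phi>\<in>test_functions V.
           set_integrable lebesgue V (\<lambda>x. C x (v x) \<bullet> gradient \<phi> x) \<and>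
           (LINT x:V|lebesgue. C x (v x) \<bullet> gradient \<phi> x) = 0))"

definition lower_semicontinuous_on :: "'a::topological_space set \<Rightarrow> ('a \<Rightarrow> ereal) \<Rightarrow> bool" where
  "lower_semicontinuous_on V u \<longleftrightarrow> (\<forall>a. openin (top_of_set V) {x \<in> V. a < u x})"

definition C_superharmonic ::
    "real \<Rightarrow> (real^'n \<Rightarrow> real) \<Rightarrow> (real^'n \<Rightarrow> real^'n \<Rightarrow> real^'n) \<Rightarrow> (real^'n) set \<Rightarrow> (real^'n \<Rightarrow> ereal) \<Rightarrow> bool" where
  "C_superharmonic p \<omega> C V u \<longleftrightarrow>
     (\<forall>x\<in>V. u x \<noteq> - \<infinity>) \<and>
     lower_semicontinuous_on V u \<and>
     (\<forall>K\<in>components V. \<exists>x\<in>K. u x \<noteq> \<infinity>) \<and>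
     (\<forall>G v. open G \<and> compactly_contained G V \<and> continuous_on (closure G) v \<and> C_harmonic p \<omega> C G v \<and>
            (\<forall>x\<in>frontier G. ereal (v x) \<le> u x) \<longrightarrow>
            (\<forall>x\<in>G. ereal (v x) \<le> u x))"


section \<open>Boundary regularity\<close>

text \<open>In the one-point compactification of the space, \<open>Some x\<close> is the finite point \<open>x\<close> and \<open>None\<close>
  is the point at infinity.\<close>

definition extended_space :: "(real^'n) option topology" where
  "extended_space = Alexandroff_compactification euclidean"

definition extended_boundary :: "(real^'n) set \<Rightarrow> (real^'n) option set" where
  "extended_boundary V = Some ` frontier V \<union> (if bounded V then {} else {None})"

text \<open>The filter of \<open>V \<ni> x \<rightarrow> z\<close>.\<close>

definition approach :: "(real^'n) set \<Rightarrow> (real^'n) option \<Rightarrow> (real^'n) filter" where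
  "approach V z = filtercomap Some (atin_within extended_space z (Some ` V))"

definition continuous_boundary_data :: "(real^'n) set \<Rightarrow> ((real^'n) option \<Rightarrow> real) set" where
  "continuous_boundary_data V =
     {f. continuous_map (subtopology extended_space (extended_boundary V)) euclidean f}"

definition upper_class ::
    "real \<Rightarrow> (real^'n \<Rightarrow> real) \<Rightarrow> (real^'n \<Rightarrow> real^'n \<Rightarrow> real^'n) \<Rightarrow> (real^'n) set \<Rightarrow>
     ((real^'n) option \<Rightarrow> real) \<Rightarrow> (real^'n \<Rightarrow> ereal) set" where
  "upper_class p \<omega> C V f =
     {u. C_superharmonic p \<omega> C V u \<and>
         (\<forall>z\<in>extended_boundary V. ereal (f z) \<le> Liminf (approach V z) u)}"

definition upper_Perron ::
    "real \<Rightarrow> (real^'n \<Rightarrow> real) \<Rightarrow> (real^'n \<Rightarrow> real^'n \<Rightarrow> real^'n) \<Rightarrow> (real^'n) set \<Rightarrow>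
     ((real^'n) option \<Rightarrow> real) \<Rightarrow> real^'n \<Rightarrow> ereal" where
  "upper_Perron p \<omega> C V f x = (INF u\<in>upper_class p \<omega> C V f. u x)"

definition C_regular ::
    "real \<Rightarrow> (real^'n \<Rightarrow> real) \<Rightarrow> (real^'n \<Rightarrow> real^'n \<Rightarrow> real^'n) \<Rightarrow> (real^'n) set \<Rightarrow> (real^'n) option \<Rightarrow> bool" where
  "C_regular p \<omega> C V x\<^sub>0 \<longleftrightarrow>
     (\<forall>f\<in>continuous_boundary_data V.
        (upper_Perron p \<omega> C V f \<longlongrightarrow> ereal (f x\<^sub>0)) (approach V x\<^sub>0))"


section \<open>Inversion\<close>

text \<open>\<open>inversion\<close> is the finite part of the inversion; its value \<open>0\<close> at \<open>0\<close> is an artefact of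
  division by zero, and \<open>extended_inversion\<close> is the map on the compactification.\<close>

definition inversion :: "real^'n \<Rightarrow> real^'n" where
  "inversion x = x /\<^sub>R (norm x)\<^sup>2"

fun extended_inversion :: "(real^'n) option \<Rightarrow> (real^'n) option" where
  "extended_inversion None = Some 0"
| "extended_inversion (Some x) = (if x = 0 then None else Some (inversion x))"

definition transformed_map ::
    "(real^'n \<Rightarrow> real^'n \<Rightarrow> real^'n) \<Rightarrow> real^'n \<Rightarrow> real^'n \<Rightarrow> real^'n" where
  "transformed_map A \<xi> q =
     (if \<xi> = 0 then 0
      else let x = inversion \<xi>; dT = jacobian inversion (at x)
           in inverse \<bar>det dT\<bar> *\<^sub>R (dT *v A x (dT *v q)))"

text \<open>For \<open>p = n\<close> this is \<open>1\<close> except at the origin, where \<open>0 powr 0 = 0\<close>; this affects only a null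
  set.\<close>

definition inversion_weight :: "real \<Rightarrow> real^'n \<Rightarrow> real" where
  "inversion_weight p \<xi> = norm \<xi> powr (2 * (p - real CARD('n)))"

end

theory Submission
  imports Defs
begin

text \<open>
  The inversion is an involution of the punctured space, and it extends to a homeomorphism of the
  one-point compactification that exchanges \<open>0\<close> and infinity. The two regularity statements are images
  of each other under composition with it, because every notion that enters the definition of
  regularity is preserved.

  The analytic core is conformality. The derivative of the inversion at \<open>\<xi>\<close> is \<open>1 / |\<xi>|\<^sup>2\<close> times a
  reflection. Hence it is self-adjoint, scales norms by \<open>1 / |\<xi>|\<^sup>2\<close>, has determinant of modulus
  \<open>1 / |\<xi>|\<^sup>2\<^sup>n\<close>, and is inverse to the derivative at the inverted point. If \<open>x\<close> is the inversion of
  \<open>\<xi>\<close>, the gradient of a composite at \<open>\<xi>\<close> is the derivative applied to the gradient at \<open>x\<close>, so two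
  identities follow: the weight \<open>w\<close> makes \<open>|\<nabla>(u \<circ> inversion)|\<^sup>p w d\<xi>\<close> equal to \<open>|\<nabla>u|\<^sup>p dx\<close>, and
  the transformed map makes the integrands of the two weak equations agree up to the Jacobian
  (\<open>Lp_pullback_field\<close>, \<open>inner_transformed_map\<close>). The functions themselves, as opposed to their
  gradients, acquire a further factor \<open>|\<xi>|\<^sup>2\<^sup>p\<close>, but it is bounded on the sets that matter, since these
  are compactly contained in a domain without the origin. With the change of variables
  \<open>change_of_variables_inversion\<close> this shows that harmonic functions correspond
  (\<open>C_harmonic_comp_inversion\<close>).

  The rest is topology. Superharmonicity is defined by semicontinuity, components, and comparison with
  harmonic functions on compactly contained sets, and all of these correspond. The extended boundary is
  the boundary in the compactification, and the filters of approach to its points are mapped to each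
  other (\<open>filtermap_inversion_approach\<close>). Therefore the upper classes, the Perron solutions and their
  boundary limits correspond as well.

  Passing to the transformed weight and map is an involution too. It is recorded by the symmetric
  relation \<open>inversion_pair\<close>, so each transport result is proved as an implication in one direction, and
  the converse is the same result for the inverted data.
\<close>

section \<open>The inversion and its derivative\<close>

lemma inversion_zero [simp]: "inversion 0 = 0"
  by (simp add: inversion_def)

lemma inversion_eq_zero_iff [simp]: "inversion x = 0 \<longleftrightarrow> x = 0"
  by (auto simp: inversion_def)

lemma norm_inversion: "norm (inversion x) = inverse (norm x)"
  by (cases "x = 0") (simp_all add: inversion_def power2_eq_square)

lemma inversion_inversion [simp]: "inversion (inversion x) = x"
proof (cases "x = 0")
  case False
  then show ?thesis
    unfolding inversion_def[of "inversion x"] norm_inversion by (simp add: inversion_def power_inverse)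
qed simp

lemma inj_inversion: "inj inversion"
  by (rule inj_on_inverseI[of _ inversion]) simp

lemma inversion_image_inversion_image [simp]: "inversion ` inversion ` G = G"
  by (simp add: image_image)

lemma inversion_image_eq_vimage: "inversion ` G = inversion -` G"
  by (auto simp: image_iff) (metis inversion_inversion)

lemma mem_inversion_image_iff: "x \<in> inversion ` G \<longleftrightarrow> inversion x \<in> G"
  by (simp add: inversion_image_eq_vimage)

lemma zero_mem_inversion_image_iff [simp]: "0 \<in> inversion ` G \<longleftrightarrow> 0 \<in> G"
  by (simp add: mem_inversion_image_iff)

text \<open>The derivative of the inversion at \<open>x\<close>: the reflection in the hyperplane orthogonal to \<open>x\<close>, scaled
  by the factor \<open>1 / (norm x)\<^sup>2\<close>.\<close>

definition inversion_derivative :: "real^'n \<Rightarrow> real^'n \<Rightarrow> real^'n" where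
  "inversion_derivative x h = (h - (2 * (x \<bullet> h) / (norm x)\<^sup>2) *\<^sub>R x) /\<^sub>R (norm x)\<^sup>2"

lemma linear_inversion_derivative: "linear (inversion_derivative x)"
  unfolding inversion_derivative_def
  by (rule linearI) (simp_all add: algebra_simps inner_add_right add_divide_distrib)

lemma inversion_has_derivative:
  assumes "x \<noteq> 0"
  shows "(inversion has_derivative inversion_derivative x) (at x within S)"
proof -
  have eq: "inversion = (\<lambda>y. inverse (y \<bullet> y) *\<^sub>R (y::real^'n))"
    by (simp add: fun_eq_iff inversion_def power2_norm_eq_inner)
  have nz: "x \<bullet> x \<noteq> 0" using assms by simp
  show ?thesis
    unfolding eq
    apply (rule has_derivative_eq_rhs)
     apply (rule derivative_intros nz)+
    using nz
    apply (auto simp: fun_eq_iff inversion_derivative_def power2_norm_eq_inner inner_commute algebra_simps divide_inverse)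
    done
qed

text \<open>Self-adjointness makes the derivative and its transpose agree, so that gradients are transported by
  the very map that the definition of \<^const>\<open>transformed_map\<close> applies to its arguments.\<close>

lemma inversion_derivative_selfadjoint:
  "inversion_derivative x a \<bullet> b = a \<bullet> inversion_derivative x b"
  by (simp add: inversion_derivative_def algebra_simps inner_commute)

text \<open>The inversion is conformal: up to the scaling its derivative is a reflection, hence an isometry.\<close>

lemma norm_inversion_derivative: "norm (inversion_derivative x h) = norm h / (norm x)\<^sup>2"
proof (cases "x = 0")
  case False
  have "(norm (h - (2 * (x \<bullet> h) / (norm x)\<^sup>2) *\<^sub>R x))\<^sup>2 = (norm h)\<^sup>2"
    using False
    by (simp add: power2_norm_eq_inner inner_diff_left inner_diff_right inner_commute)
  then have "norm (h - (2 * (x \<bullet> h) / (norm x)\<^sup>2) *\<^sub>R x) = norm h"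
    by (simp add: power2_eq_iff_nonneg)
  then show ?thesis by (simp add: inversion_derivative_def divide_inverse_commute)
qed (simp add: inversion_derivative_def)

lemma inversion_derivative_inversion:
  "inversion_derivative (inversion x) h = (norm x)^4 *\<^sub>R inversion_derivative x h"
  by (cases "x = 0")
     (simp_all add: inversion_derivative_def norm_inversion inversion_def[of x] field_simps power2_eq_square
        eval_nat_numeral algebra_simps)

text \<open>The chain rule for the identity \<open>inversion \<circ> inversion = id\<close>, here read off from the formula: the
  reflection at \<open>inversion x\<close> is that at \<open>x\<close>, an involution, and the two scaling factors cancel.\<close>

lemma inversion_derivative_cancel:
  assumes "x \<noteq> 0"
  shows "inversion_derivative (inversion x) (inversion_derivative x h) = h"
proof -
  define n where "n = norm x"
  have n: "n \<noteq> 0" and xx: "x \<bullet> x = n^2" using assms by (auto simp: n_def power2_norm_eq_inner)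
  have "inversion_derivative x (inversion_derivative x h) = h /\<^sub>R n^4"
    using n unfolding inversion_derivative_def n_def[symmetric]
    by (simp add: inner_diff_right xx algebra_simps power2_eq_square eval_nat_numeral)
  then show ?thesis using n by (simp add: inversion_derivative_inversion n_def)
qed

text \<open>The derivative is the composition of a reflection, of determinant \<open>-1\<close>, and a homothety.\<close>

lemma abs_det_inversion_derivative:
  fixes x :: "real^'n"
  assumes "x \<noteq> 0"
  shows "\<bar>det (matrix (inversion_derivative x))\<bar> = 1 / norm x ^ (2 * CARD('n))"
proof -
  \<comment> \<open>The reflection whose multiple the derivative is.\<close>
  define R where "R = (\<lambda>h. (norm x)\<^sup>2 *\<^sub>R inversion_derivative x h)"
  have lin: "linear R"
    unfolding R_def by (intro linear_compose_scale_right linear_inversion_derivative)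
  have "orthogonal_transformation R"
    unfolding orthogonal_transformation using lin assms
    by (simp add: R_def norm_inversion_derivative)
  then have 1: "\<bar>det (matrix R)\<bar> = 1" by simp
  have eq: "inversion_derivative x = (*\<^sub>R) (inverse ((norm x)\<^sup>2)) \<circ> R"
    using assms by (simp add: R_def fun_eq_iff)
  have "matrix (inversion_derivative x) = matrix ((*\<^sub>R) (inverse ((norm x)\<^sup>2))) ** matrix R"
    unfolding eq by (rule matrix_compose[OF lin]) (simp add: linear_scaleR)
  then have "det (matrix (inversion_derivative x)) = inverse ((norm x)\<^sup>2) ^ CARD('n) * det (matrix R)"
    by (simp add: det_mul det_matrix_scaleR)
  then show ?thesis using 1 assms
    by (simp add: abs_mult power_mult power_one_over inverse_eq_divide)
qed

lemma jacobian_inversion: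
  assumes "x \<noteq> 0"
  shows "jacobian inversion (at x) = matrix (inversion_derivative x)"
  by (simp add: jacobian_def frechet_derivative_at[OF inversion_has_derivative[OF assms], symmetric])

lemma transformed_map_eq:
  fixes C :: "real^'n \<Rightarrow> real^'n \<Rightarrow> real^'n"
  assumes "\<xi> \<noteq> 0"
  shows "transformed_map C \<xi> q = inverse (norm \<xi> ^ (2 * CARD('n))) *\<^sub>R
    inversion_derivative (inversion \<xi>) (C (inversion \<xi>) (inversion_derivative (inversion \<xi>) q))"
  using assms
  by (simp add: transformed_map_def Let_def jacobian_inversion abs_det_inversion_derivative
      fun_cong[OF matrix_vector_mul(2)[OF linear_inversion_derivative]] norm_inversion power_inverse)

section \<open>Topology away from the origin\<close>

lemma continuous_on_inversion: "0 \<notin> S \<Longrightarrow> continuous_on S inversion"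
  by (intro has_derivative_continuous_on[OF inversion_has_derivative]) auto

lemma continuous_on_comp_inversion:
  fixes u :: "real^'n \<Rightarrow> 'b::topological_space"
  assumes "continuous_on V u" "0 \<notin> V"
  shows "continuous_on (inversion ` V) (\<lambda>\<xi>. u (inversion \<xi>))"
proof (rule continuous_on_compose2[OF assms(1)])
  show "continuous_on (inversion ` V) inversion"
    using assms(2) by (intro continuous_on_inversion) auto
qed simp

lemma open_inversion_image:
  fixes S :: "(real^'n) set"
  assumes "open S" "0 \<notin> S"
  shows "open (inversion ` S)"
proof -
  have "continuous_on (- {0}) (inversion :: real^'n \<Rightarrow> real^'n)"
    by (intro continuous_on_inversion) auto
  then have "open (- {0} \<inter> inversion -` S :: (real^'n) set)"
    by (rule continuous_open_preimage) (use assms in auto)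
  moreover have "- {0} \<inter> inversion -` S = inversion ` S"
    using assms by (auto simp: inversion_image_eq_vimage)
  ultimately show ?thesis by simp
qed

lemma compact_inversion_image:
  fixes K :: "(real^'n) set"
  assumes "compact K" "0 \<notin> K"
  shows "compact (inversion ` K)"
  using assms by (intro compact_continuous_image continuous_on_inversion) auto

text \<open>Compactness and distance from the origin keep the closure within the domain on which the inversion
  is a homeomorphism.\<close>

lemma closure_inversion_image:
  fixes G :: "(real^'n) set"
  assumes "compact (closure G)" "0 \<notin> closure G"
  shows "closure (inversion ` G) = inversion ` closure G"
proof -
  have K: "compact (inversion ` closure G)"
    by (rule compact_inversion_image[OF assms])
  have 1: "closure (inversion ` G) \<subseteq> inversion ` closure G"
    by (rule closure_minimal[OF image_mono[OF closure_subset] compact_imp_closed[OF K]])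
  then have *: "compact (closure (inversion ` G))" "0 \<notin> closure (inversion ` G)"
    using compact_imp_bounded[OF K] bounded_subset assms(2)
    by (auto simp: compact_eq_bounded_closed)
  \<comment> \<open>The first inclusion, applied to the inverted set, gives the reverse one.\<close>
  have "closure (inversion ` inversion ` G) \<subseteq> inversion ` closure (inversion ` G)"
    by (rule closure_minimal[OF image_mono[OF closure_subset] compact_imp_closed[OF compact_inversion_image[OF *]]])
  then have "inversion ` closure G \<subseteq> inversion ` inversion ` closure (inversion ` G)"
    by (intro image_mono) simp
  with 1 show ?thesis by simp
qed

lemma frontier_inversion_image:
  fixes G :: "(real^'n) set"
  assumes "open G" "compact (closure G)" "0 \<notin> closure G"
  shows "frontier (inversion ` G) = inversion ` frontier G"
proof -
  have "0 \<notin> G" using assms(3) closure_subset by blast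
  have "open (inversion ` G)" by (rule open_inversion_image[OF assms(1) \<open>0 \<notin> G\<close>])
  then show ?thesis
    using assms(1)
    by (simp add: frontier_def interior_open closure_inversion_image[OF assms(2,3)]
        image_set_diff[OF inj_inversion])
qed

lemma compactly_contained_inversion_image:
  assumes "compactly_contained G V" "0 \<notin> V"
  shows "compactly_contained (inversion ` G) (inversion ` V)"
proof -
  have *: "compact (closure G)" "0 \<notin> closure G"
    using assms by (auto simp: compactly_contained_def)
  show ?thesis
    using assms closure_inversion_image[OF *] compact_inversion_image[OF *]
    by (auto simp: compactly_contained_def)
qed

text \<open>Sets compactly contained in an inverted domain are bounded and correspond to sets compactly contained
  in the domain itself; all local notions can thus be checked on the inverted sets.\<close>

lemma inversion_image_compactly_contained:
  fixes G :: "(real^'n) set"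
  assumes "open G" "compactly_contained G (inversion ` V)" "0 \<notin> V"
  shows "open (inversion ` G)" "compactly_contained (inversion ` G) V" "0 \<notin> inversion ` G"
    and "bounded (inversion ` inversion ` G)"
proof -
  have 0: "0 \<notin> G"
    using assms(2,3) closure_subset[of G] by (auto simp: compactly_contained_def)
  then show "0 \<notin> inversion ` G" by simp
  show "open (inversion ` G)" by (rule open_inversion_image[OF assms(1) 0])
  show "compactly_contained (inversion ` G) V"
    using compactly_contained_inversion_image[OF assms(2)] assms(3) by simp
  have "bounded (closure G)"
    using assms(2) by (simp add: compactly_contained_def compact_imp_bounded)
  then show "bounded (inversion ` inversion ` G)"
    using bounded_subset closure_subset by auto
qed

text \<open>A component of the inverted domain contains the image of a component of the domain, because that image
  is connected. The condition that a superharmonic function be not identically infinite on a component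
  needs no more than this inclusion.\<close>

lemma component_inversion_image:
  fixes V :: "(real^'n) set"
  assumes "K \<in> components (inversion ` V)" "0 \<notin> V"
  obtains L where "L \<in> components V" "inversion ` L \<subseteq> K"
proof -
  obtain \<xi> where \<xi>: "\<xi> \<in> inversion ` V" and K: "K = connected_component_set (inversion ` V) \<xi>"
    using assms(1) by (auto simp: components_def)
  let ?L = "connected_component_set V (inversion \<xi>)"
  have x: "inversion \<xi> \<in> V" using \<xi> by (simp add: mem_inversion_image_iff)
  have L: "?L \<subseteq> V" by (rule connected_component_subset)
  have "continuous_on ?L inversion"
    using L assms(2) by (intro continuous_on_inversion) blast
  then have "connected (inversion ` ?L)"
    by (rule connected_continuous_image) (rule connected_connected_component)
  moreover have "\<xi> \<in> inversion ` ?L"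
    using x by (simp add: mem_inversion_image_iff)
  ultimately have "inversion ` ?L \<subseteq> K"
    unfolding K using image_mono[OF L] by (intro connected_component_maximal)
  moreover have "?L \<in> components V" using x by (auto simp: components_def)
  ultimately show thesis by (rule that[rotated])
qed

section \<open>Change of variables\<close>

text \<open>The transformation formula for integrals is applied over a well-ordered index type. An arbitrary
  finite index type has a copy with a well-order, and relabelling coordinates preserves Lebesgue
  measure and commutes with the inversion, which carries the formula over to the original type.\<close>

typedef 'a ordered_copy = "UNIV :: 'a set" ..

instance ordered_copy :: (finite) finite
  by (intro_classes, rule finite_imageD[of Rep_ordered_copy])
     (auto intro: finite_subset[OF subset_UNIV] injI simp: inj_on_def Rep_ordered_copy_inject)

definition index_of :: "'a::finite ordered_copy \<Rightarrow> nat" where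
  "index_of = (SOME f. inj f)"

lemma inj_index_of: "inj index_of"
proof -
  obtain f :: "'a ordered_copy \<Rightarrow> nat" where "inj f"
    using finite_imp_inj_to_nat_seg[OF finite, of "UNIV :: 'a ordered_copy set"] by blast
  then show ?thesis
    unfolding index_of_def by (rule someI[of inj])
qed

instantiation ordered_copy :: (finite) wellorder
begin
definition "x \<le> y \<longleftrightarrow> index_of x \<le> index_of y"
definition "x < y \<longleftrightarrow> index_of x < index_of y"
instance
proof
  fix P :: "'a ordered_copy \<Rightarrow> bool" and a
  assume step: "\<And>x. (\<And>y. y < x \<Longrightarrow> P y) \<Longrightarrow> P x"
  show "P a"
  proof (induction "index_of a" arbitrary: a rule: less_induct)
    case less
    show ?case
      by (rule step, rule less.hyps) (simp add: less_ordered_copy_def)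
  qed
next
  fix x y :: "'a ordered_copy"
  assume "x \<le> y" "y \<le> x"
  then have "index_of x = index_of y" by (simp add: less_eq_ordered_copy_def)
  then show "x = y" by (rule injD[OF inj_index_of])
qed (auto simp: less_eq_ordered_copy_def less_ordered_copy_def)
end

definition reindex :: "real^'n \<Rightarrow> real^('n ordered_copy)" where
  "reindex x = (\<chi> i. x $ Rep_ordered_copy i)"

definition unindex :: "real^('n ordered_copy) \<Rightarrow> real^'n" where
  "unindex y = (\<chi> i. y $ Abs_ordered_copy i)"

lemma unindex_reindex [simp]: "unindex (reindex x) = x"
  by (simp add: reindex_def unindex_def vec_eq_iff Abs_ordered_copy_inverse)

lemma reindex_unindex [simp]: "reindex (unindex x) = x"
  by (simp add: reindex_def unindex_def vec_eq_iff Rep_ordered_copy_inverse)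

lemma bij_Rep_ordered_copy: "bij (Rep_ordered_copy :: 'n ordered_copy \<Rightarrow> 'n)"
  by (metis Abs_ordered_copy_inverse Rep_ordered_copy_inverse UNIV_I bijI')

lemma card_ordered_copy [simp]: "CARD('n ordered_copy) = CARD('n::finite)"
  using bij_betw_same_card[OF bij_Rep_ordered_copy] .

lemma linear_reindex: "linear reindex"
  by (rule linearI) (simp_all add: reindex_def vec_eq_iff)

lemma linear_unindex: "linear unindex"
  by (rule linearI) (simp_all add: unindex_def vec_eq_iff)

lemma norm_reindex [simp]: "norm (reindex x) = norm x"
  unfolding norm_vec_def L2_set_def reindex_def
  using sum.reindex_bij_betw[OF bij_Rep_ordered_copy, of "\<lambda>i. (norm (x $ i))\<^sup>2"] by simp

lemma reindex_inversion: "reindex (inversion x) = inversion (reindex x)"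
  by (simp add: inversion_def linear_cmul[OF linear_reindex])

lemma reindex_measurable [measurable]: "reindex \<in> borel_measurable borel"
  using linear_continuous_on[OF linear_linear[THEN iffD2, OF linear_reindex]]
  by (intro borel_measurable_continuous_onI)

text \<open>Relabelling maps boxes to boxes of the same volume.\<close>

lemma distr_lborel_reindex: "distr lborel borel reindex = (lborel :: (real^('n::finite ordered_copy)) measure)"
proof (rule lborel_eqI[symmetric])
  fix l u :: "real^'n ordered_copy"
  assume le: "\<And>b. b \<in> Basis \<Longrightarrow> l \<bullet> b \<le> u \<bullet> b"
  have le': "l $ i \<le> u $ i" for i
    using le[of "axis i 1"] by (simp add: inner_axis)
  have prod_Basis: "(\<Prod>b\<in>Basis. (v :: real^'k) \<bullet> b) = (\<Prod>i\<in>UNIV. v $ i)" for v :: "real^'k"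
  proof -
    have "Basis = (\<lambda>i. axis i 1 :: real^'k) ` UNIV" by (auto simp: Basis_vec_def)
    then have "(\<Prod>b\<in>Basis. v \<bullet> b) = (\<Prod>b\<in>range (\<lambda>i. axis i 1). v \<bullet> b)" by simp
    also have "\<dots> = (\<Prod>i\<in>UNIV. v \<bullet> axis i 1)"
      by (subst prod.reindex) (auto simp: inj_on_def axis_eq_axis)
    finally show ?thesis by (simp add: inner_axis)
  qed
  have vim: "reindex -` box l u = box (unindex l) (unindex u)"
    apply (auto simp: mem_box_cart reindex_def unindex_def)
    apply (metis Abs_ordered_copy_inverse UNIV_I)
    apply (metis Abs_ordered_copy_inverse UNIV_I)
    apply (metis Rep_ordered_copy_inverse)
    apply (metis Rep_ordered_copy_inverse)
    done
  have "emeasure (distr lborel borel reindex) (box l u) = emeasure lborel (box (unindex l) (unindex u))"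
    by (simp add: emeasure_distr vim)
  also have "\<dots> = ennreal (\<Prod>b\<in>Basis. (unindex u - unindex l) \<bullet> b)"
    by (rule emeasure_lborel_box) (auto simp: Basis_vec_def inner_axis unindex_def le')
  also have "(\<Prod>b\<in>Basis. (unindex u - unindex l) \<bullet> b) = (\<Prod>i\<in>UNIV. (u - l) $ i)"
    unfolding prod_Basis
    by (subst prod.reindex_bij_betw[OF bij_Rep_ordered_copy, symmetric])
       (simp add: unindex_def Rep_ordered_copy_inverse)
  finally show "emeasure (distr lborel borel reindex) (box l u) = ennreal (\<Prod>b\<in>Basis. (u - l) \<bullet> b)"
    by (simp add: prod_Basis)
qed simp

lemma measurable_reindex_lebesgue:
  "reindex \<in> lebesgue \<rightarrow>\<^sub>M (lebesgue :: (real^('n::finite ordered_copy)) measure)"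
proof (rule measurableI)
  fix S :: "(real^('n ordered_copy)) set"
  assume "S \<in> sets lebesgue"
  moreover have "reindex -` S = unindex ` S" by (auto simp: image_iff) (metis unindex_reindex)
  ultimately show "reindex -` S \<inter> space lebesgue \<in> sets lebesgue"
    by (simp add: differentiable_image_in_sets_lebesgue linear_imp_differentiable_on linear_unindex)
qed simp

lemma measurable_unindex_lebesgue:
  "unindex \<in> (lebesgue :: (real^('n::finite ordered_copy)) measure) \<rightarrow>\<^sub>M lebesgue"
proof (rule measurableI)
  fix S :: "(real^'n) set"
  assume "S \<in> sets lebesgue"
  moreover have "unindex -` S = reindex ` S" by (auto simp: image_iff) (metis reindex_unindex)
  ultimately show "unindex -` S \<inter> space lebesgue \<in> sets lebesgue"
    by (simp add: differentiable_image_in_sets_lebesgue linear_imp_differentiable_on linear_reindex)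
qed simp

lemma distr_lebesgue_reindex:
  "distr lebesgue lebesgue reindex = (lebesgue :: (real^('n::finite ordered_copy)) measure)"
proof -
  have eq: "distr lebesgue lborel reindex = (lborel :: (real^('n::finite ordered_copy)) measure)"
    using distr_lborel_reindex by (simp add: distr_completion cong: distr_cong)
  show ?thesis
    by (subst completion.completion_distr_eq[symmetric])
       (simp_all add: eq measurable_completion)
qed

text \<open>The integrability equivalence includes functions \<open>f\<close> that are not measurable; for these the bijection
  shows that the relabelled function is not measurable either.\<close>

lemma change_of_variables_reindex:
  fixes f :: "real^('n::finite ordered_copy) \<Rightarrow> real"
  shows "set_integrable lebesgue (reindex -` S) (\<lambda>x. f (reindex x)) \<longleftrightarrow> set_integrable lebesgue S f"
    and "(LINT x:reindex -` S|lebesgue. f (reindex x)) = (LINT y:S|lebesgue. f y)"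
proof -
  have ind: "indicat_real (reindex -` S) x = indicator S (reindex x)" for x
    by (simp add: indicator_def)
  have meas: "h \<in> borel_measurable lebesgue"
    if "(\<lambda>x. h (reindex x)) \<in> borel_measurable lebesgue" for h :: "real^('n::finite ordered_copy) \<Rightarrow> real"
    using measurable_compose[OF measurable_unindex_lebesgue that] by simp
  have *: "integrable lebesgue (\<lambda>x. h (reindex x)) \<longleftrightarrow> integrable lebesgue h"
    "(LINT x|lebesgue. h (reindex x)) = (LINT x|lebesgue. h x)"
    for h :: "real^('n::finite ordered_copy) \<Rightarrow> real"
  proof -
    show iff: "integrable lebesgue (\<lambda>x. h (reindex x)) \<longleftrightarrow> integrable lebesgue h"
    proof (cases "h \<in> borel_measurable lebesgue")
      case True
      then show ?thesis
        using integrable_distr_eq[OF measurable_reindex_lebesgue True] by (simp only: distr_lebesgue_reindex)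
    next
      case False
      then have "(\<lambda>x. h (reindex x)) \<notin> borel_measurable lebesgue" using meas by blast
      with False show ?thesis by (meson borel_measurable_integrable)
    qed
    show "(LINT x|lebesgue. h (reindex x)) = (LINT x|lebesgue. h x)"
    proof (cases "integrable lebesgue h")
      case True
      then show ?thesis
        using integral_distr[OF measurable_reindex_lebesgue borel_measurable_integrable[OF True]]
        by (simp only: distr_lebesgue_reindex)
    next
      case False
      then show ?thesis using iff by (simp add: not_integrable_integral_eq)
    qed
  qed
  show "set_integrable lebesgue (reindex -` S) (\<lambda>x. f (reindex x)) \<longleftrightarrow> set_integrable lebesgue S f"
    unfolding set_integrable_def ind by (rule *(1))
  show "(LINT x:reindex -` S|lebesgue. f (reindex x)) = (LINT y:S|lebesgue. f y)"
    unfolding set_lebesgue_integral_def ind by (rule *(2))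
qed

lemma change_of_variables_inversion_wellorder:
  fixes f :: "real^('n::{finite,wellorder}) \<Rightarrow> real"
  assumes "0 \<notin> G"
  shows "set_integrable lebesgue (inversion ` G) (\<lambda>\<xi>. f (inversion \<xi>) / norm \<xi> ^ (2 * CARD('n))) \<longleftrightarrow>
         set_integrable lebesgue G f"
    and "(LINT \<xi>:inversion ` G|lebesgue. f (inversion \<xi>) / norm \<xi> ^ (2 * CARD('n))) =
         (LINT x:G|lebesgue. f x)"
proof -
  let ?g = "\<lambda>\<xi>. f (inversion \<xi>) / norm \<xi> ^ (2 * CARD('n))"
  let ?h = "\<lambda>\<xi>. \<bar>det (matrix (inversion_derivative \<xi>))\<bar> * f (inversion \<xi>)"
  let ?S = "inversion ` G"
  have nz: "\<xi> \<noteq> 0" if "\<xi> \<in> ?S" for \<xi> using that assms by auto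
  have cov: "?h absolutely_integrable_on ?S \<and> integral ?S ?h = b \<longleftrightarrow>
      f absolutely_integrable_on G \<and> integral G f = b" for b
  proof (rule cov_invertible_real[where h = inversion and h' = inversion_derivative])
    show "inversion_derivative y \<circ> inversion_derivative (inversion y) = id" if "y \<in> G" for y
    proof -
      have "inversion y \<noteq> 0" using that assms by auto
      then show ?thesis
        using inversion_derivative_cancel[of "inversion y"] by (simp add: fun_eq_iff)
    qed
  qed (use assms in \<open>auto intro!: inversion_has_derivative\<close>)
  have eq: "?h \<xi> = ?g \<xi>" if "\<xi> \<in> ?S" for \<xi>
    using nz[OF that] by (simp add: abs_det_inversion_derivative)
  have abs_eq: "?h absolutely_integrable_on ?S \<longleftrightarrow> ?g absolutely_integrable_on ?S"
    by (rule set_integrable_cong) (simp_all add: eq)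
  have int_eq: "integral ?S ?h = integral ?S ?g"
    by (rule integral_cong) (rule eq)
  show A: "set_integrable lebesgue ?S ?g \<longleftrightarrow> set_integrable lebesgue G f"
    using cov abs_eq by blast
  show "(LINT \<xi>:?S|lebesgue. ?g \<xi>) = (LINT x:G|lebesgue. f x)"
  proof (cases "set_integrable lebesgue G f")
    case True
    then show ?thesis
      using A cov[of "integral G f"] int_eq by (simp add: set_lebesgue_integral_eq_integral)
  next
    case False
    then show ?thesis
      using A unfolding set_lebesgue_integral_def set_integrable_def by (simp add: not_integrable_integral_eq)
  qed
qed

text \<open>The transformation formula \<open>dx = d\<xi> / |\<xi>|\<^sup>2\<^sup>n\<close> for \<open>x = inversion \<xi>\<close>.\<close>

lemma change_of_variables_inversion:
  fixes f :: "real^'n \<Rightarrow> real"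
  assumes "0 \<notin> G"
  shows set_integrable_inversion:
      "set_integrable lebesgue (inversion ` G) (\<lambda>\<xi>. f (inversion \<xi>) / norm \<xi> ^ (2 * CARD('n))) \<longleftrightarrow>
       set_integrable lebesgue G f"
    and set_integral_inversion:
      "(LINT \<xi>:inversion ` G|lebesgue. f (inversion \<xi>) / norm \<xi> ^ (2 * CARD('n))) =
       (LINT x:G|lebesgue. f x)"
proof -
  let ?S = "unindex -` G :: (real^('n ordered_copy)) set"
  let ?k = "\<lambda>y. f (unindex y) :: real"
  let ?g = "\<lambda>y. ?k (inversion y) / norm y ^ (2 * CARD('n))"
  have G: "reindex -` ?S = G"
    by (rule set_eqI) simp
  have IG: "reindex -` inversion ` ?S = inversion ` G"
    by (rule set_eqI) (simp add: mem_inversion_image_iff flip: reindex_inversion)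
  have k: "?k (reindex x) = f x" for x
    by simp
  have g: "?g (reindex x) = f (inversion x) / norm x ^ (2 * CARD('n))" for x
    by (simp flip: reindex_inversion)
  have "unindex (0 :: real^('n ordered_copy)) = 0"
    by (rule linear_0[OF linear_unindex])
  then have "0 \<notin> ?S" using assms by simp
  note cov = change_of_variables_inversion_wellorder[OF this, of ?k, unfolded card_ordered_copy]
  show "set_integrable lebesgue (inversion ` G) (\<lambda>\<xi>. f (inversion \<xi>) / norm \<xi> ^ (2 * CARD('n))) \<longleftrightarrow>
       set_integrable lebesgue G f"
    using change_of_variables_reindex(1)[of "inversion ` ?S" ?g, unfolded IG g] cov(1)
      change_of_variables_reindex(1)[of ?S ?k, unfolded G k]
    by (rule trans[OF trans, OF _ _ sym])
  show "(LINT \<xi>:inversion ` G|lebesgue. f (inversion \<xi>) / norm \<xi> ^ (2 * CARD('n))) =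
       (LINT x:G|lebesgue. f x)"
    using change_of_variables_reindex(2)[of "inversion ` ?S" ?g, unfolded IG g] cov(2)
      change_of_variables_reindex(2)[of ?S ?k, unfolded G k]
    by (rule trans[OF trans, OF _ _ sym])
qed

section \<open>Smooth functions and gradients\<close>

text \<open>On an open set the derivatives at a point of the set depend only on the values in the set.\<close>

lemma Ck_on_cong:
  assumes "open S" and "\<And>x. x \<in> S \<Longrightarrow> f x = g x"
  shows "Ck_on k S f \<longleftrightarrow> Ck_on k S g"
  using assms(2)
proof (induction k arbitrary: f g)
  case 0
  then show ?case by (simp cong: continuous_on_cong)
next
  case (Suc k)
  have der: "(f has_derivative D) (at x) \<longleftrightarrow> (g has_derivative D) (at x)" if "x \<in> S" for x D
    using has_derivative_transform_within_open[OF _ assms(1) that, of f D UNIV g]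
      has_derivative_transform_within_open[OF _ assms(1) that, of g D UNIV f] Suc.prems by metis
  have "Ck_on k S (\<lambda>x. frechet_derivative f (at x) v) \<longleftrightarrow>
    Ck_on k S (\<lambda>x. frechet_derivative g (at x) v)" for v
    by (rule Suc.IH) (simp add: frechet_derivative_def der)
  then show ?case by (simp add: differentiable_def der)
qed

text \<open>A formula for the derivative on the set replaces the chosen \<^const>\<open>frechet_derivative\<close>; this is how
  the classes \<open>C\<^sup>k\<close> of sums, products and composites are computed.\<close>

lemma Ck_on_SucI:
  assumes "open S" and der: "\<And>x. x \<in> S \<Longrightarrow> (f has_derivative D x) (at x)"
    and "\<And>v. Ck_on k S (\<lambda>x. D x v)"
  shows "Ck_on (Suc k) S f"
proof -
  have "Ck_on k S (\<lambda>x. frechet_derivative f (at x) v)" for v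
    using assms(3)[of v]
    by (rule Ck_on_cong[OF assms(1), THEN iffD1, rotated]) (metis der frechet_derivative_at)
  then show ?thesis using der by (auto simp: differentiable_def)
qed

lemma Ck_on_SucD:
  assumes "Ck_on (Suc k) S f"
  shows "x \<in> S \<Longrightarrow> (f has_derivative frechet_derivative f (at x)) (at x)"
    and "Ck_on k S (\<lambda>x. frechet_derivative f (at x) v)"
  using assms by (auto simp: frechet_derivative_works)

lemma Ck_on_Suc_imp: "Ck_on (Suc k) S f \<Longrightarrow> Ck_on k S f"
proof (induction k arbitrary: f)
  case 0
  then show ?case
    by (auto intro!: continuous_at_imp_continuous_on differentiable_imp_continuous_within)
next
  case (Suc k)
  then have "Ck_on k S (\<lambda>x. frechet_derivative f (at x) v)" for v
    by (intro Suc.IH Ck_on_SucD(2))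
  moreover have "\<forall>x\<in>S. f differentiable (at x)"
    using Suc.prems by (subst (asm) Ck_on.simps(2)) blast
  ultimately show ?case by (subst Ck_on.simps(2)) blast
qed

lemma Ck_on_subset: "Ck_on k S f \<Longrightarrow> S' \<subseteq> S \<Longrightarrow> Ck_on k S' f"
  by (induction k arbitrary: f) (auto intro: continuous_on_subset)

lemma Ck_on_Un:
  assumes "open S" "open S'"
  shows "Ck_on k S f \<Longrightarrow> Ck_on k S' f \<Longrightarrow> Ck_on k (S \<union> S') f"
  by (induction k arbitrary: f) (auto intro: continuous_on_open_Un assms)

lemma Ck_on_const: "open S \<Longrightarrow> Ck_on k S (\<lambda>x. c)"
proof (induction k arbitrary: c)
  case (Suc k)
  then show ?case by (intro Ck_on_SucI[where D = "\<lambda>x v. 0"]) auto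
qed simp

lemma Ck_on_linear:
  assumes "open S" "bounded_linear f"
  shows "Ck_on k S f"
proof (cases k)
  case 0
  then show ?thesis by (simp add: assms(2) linear_continuous_on)
next
  case (Suc m)
  show ?thesis unfolding Suc
    by (rule Ck_on_SucI[where D = "\<lambda>x. f"])
       (auto intro: assms bounded_linear_imp_has_derivative Ck_on_const)
qed

lemma Ck_on_add:
  fixes f g :: "'a::real_normed_vector \<Rightarrow> real"
  assumes "open S" "Ck_on k S f" "Ck_on k S g"
  shows "Ck_on k S (\<lambda>x. f x + g x)"
  using assms(2,3)
proof (induction k arbitrary: f g)
  case 0
  then show ?case by (auto intro: continuous_intros)
next
  case (Suc k)
  show ?case
  proof (rule Ck_on_SucI[OF assms(1)])
    show "((\<lambda>x. f x + g x) has_derivative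
        (\<lambda>v. frechet_derivative f (at x) v + frechet_derivative g (at x) v)) (at x)" if "x \<in> S" for x
      by (rule has_derivative_add[OF Ck_on_SucD(1) Ck_on_SucD(1)]) (rule Suc.prems that)+
    show "Ck_on k S (\<lambda>x. frechet_derivative f (at x) v + frechet_derivative g (at x) v)" for v
      by (rule Suc.IH[OF Ck_on_SucD(2) Ck_on_SucD(2)]) (rule Suc.prems)+
  qed
qed

lemma Ck_on_mult:
  fixes f g :: "'a::real_normed_vector \<Rightarrow> real"
  assumes "open S" "Ck_on k S f" "Ck_on k S g"
  shows "Ck_on k S (\<lambda>x. f x * g x)"
  using assms(2,3)
proof (induction k arbitrary: f g)
  case 0
  then show ?case by (auto intro: continuous_intros)
next
  case (Suc k)
  show ?case
  proof (rule Ck_on_SucI[OF assms(1)])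
    show "((\<lambda>x. f x * g x) has_derivative
        (\<lambda>v. f x * frechet_derivative g (at x) v + frechet_derivative f (at x) v * g x)) (at x)" if "x \<in> S" for x
      by (rule has_derivative_mult[OF Ck_on_SucD(1) Ck_on_SucD(1)]) (rule Suc.prems that)+
    show "Ck_on k S (\<lambda>x. f x * frechet_derivative g (at x) v + frechet_derivative f (at x) v * g x)" for v
      by (rule Ck_on_add[OF assms(1) Suc.IH Suc.IH,
            OF Ck_on_Suc_imp Ck_on_SucD(2) Ck_on_SucD(2) Ck_on_Suc_imp]) (rule Suc.prems)+
  qed
qed

lemma Ck_on_sum:
  fixes f :: "'i \<Rightarrow> 'a::real_normed_vector \<Rightarrow> real"
  assumes "open S" "\<And>i. i \<in> I \<Longrightarrow> Ck_on k S (f i)"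
  shows "Ck_on k S (\<lambda>x. \<Sum>i\<in>I. f i x)"
  using assms(2)
  by (induction I rule: infinite_finite_induct) (auto intro: Ck_on_const Ck_on_add assms(1))

text \<open>The derivative of \<open>1 / |x|\<^sup>2\<close> is a linear function times \<open>(1 / |x|\<^sup>2)\<^sup>2\<close>, which makes the induction on \<open>k\<close>
  reproduce itself.\<close>

lemma Ck_on_inverse_norm_square:
  fixes S :: "'a::real_inner set"
  assumes "open S" "0 \<notin> S"
  shows "Ck_on k S (\<lambda>x. inverse (x \<bullet> x))"
proof (induction k)
  case 0
  show ?case using assms(2) by (auto intro!: continuous_intros)
next
  case (Suc k)
  show ?case
  proof (rule Ck_on_SucI[OF assms(1)])
    show "((\<lambda>x. inverse (x \<bullet> x)) has_derivative
        (\<lambda>v. ((- 2) *\<^sub>R x \<bullet> v) * (inverse (x \<bullet> x) * inverse (x \<bullet> x)))) (at x)" if "x \<in> S" for x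
    proof -
      have "x \<bullet> x \<noteq> 0" using that assms(2) by auto
      then show ?thesis
        by (auto intro!: derivative_eq_intros simp: inner_commute algebra_simps)
    qed
    have "bounded_linear (\<lambda>x. (- 2) *\<^sub>R x \<bullet> v)" for v :: 'a
      by (intro bounded_linear_intros)
    then show "Ck_on k S (\<lambda>x. ((- 2) *\<^sub>R x \<bullet> v) * (inverse (x \<bullet> x) * inverse (x \<bullet> x)))" for v
      by (intro Ck_on_mult Ck_on_linear[OF assms(1)] assms(1) Suc.IH) auto
  qed
qed

lemma Ck_on_inversion_derivative:
  fixes S :: "(real^'n) set"
  assumes "open S" "0 \<notin> S"
  shows "Ck_on k S (\<lambda>\<xi>. inversion_derivative \<xi> v $ i)"
proof -
  let ?q = "\<lambda>\<xi>::real^'n. inverse (\<xi> \<bullet> \<xi>)"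
  have 1: "bounded_linear (\<lambda>\<xi>::real^'n. \<xi> \<bullet> ((- 2) *\<^sub>R v))" "bounded_linear (\<lambda>\<xi>::real^'n. \<xi> $ i)"
    by (rule bounded_linear_inner_left, rule bounded_linear_vec_nth)
  have eq: "(\<lambda>\<xi>. inversion_derivative \<xi> v $ i) = (\<lambda>\<xi>. v $ i * ?q \<xi> + (\<xi> \<bullet> ((- 2) *\<^sub>R v)) * (\<xi> $ i * (?q \<xi> * ?q \<xi>)))"
    by (simp add: fun_eq_iff inversion_derivative_def power2_norm_eq_inner divide_inverse algebra_simps)
  show ?thesis unfolding eq
    by (intro Ck_on_add Ck_on_mult Ck_on_const Ck_on_linear[OF _ 1(1)] Ck_on_linear[OF _ 1(2)]
        Ck_on_inverse_norm_square assms)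
qed

lemma linear_expansion:
  fixes f :: "real^'n \<Rightarrow> real"
  assumes "linear f"
  shows "f v = (\<Sum>i\<in>UNIV. v $ i * f (axis i 1))"
  by (subst basis_expansion[of v, symmetric])
     (simp add: linear_sum[OF assms] linear_cmul[OF assms] scalar_mult_eq_scaleR)

lemma has_derivative_comp_inversion:
  assumes "(\<phi> has_derivative D) (at (inversion \<xi>))" "\<xi> \<noteq> 0"
  shows "((\<lambda>x. \<phi> (inversion x)) has_derivative (\<lambda>v. D (inversion_derivative \<xi> v))) (at \<xi>)"
  using has_derivative_compose[OF inversion_has_derivative[OF assms(2)] assms(1)] .

text \<open>By the chain rule the directional derivatives of the composite are sums of components of the derivative
  of the inversion times partial derivatives of \<open>\<phi>\<close> composed with the inversion; the former are smooth
  and the latter are handled by induction.\<close>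

lemma Ck_on_comp_inversion:
  fixes \<phi> :: "real^'n \<Rightarrow> real"
  assumes "open S" "0 \<notin> S" "Ck_on k S \<phi>"
  shows "Ck_on k (inversion ` S) (\<lambda>\<xi>. \<phi> (inversion \<xi>))"
  using assms(3)
proof (induction k arbitrary: \<phi>)
  case 0
  have "continuous_on (inversion ` S) inversion"
    using assms by (intro continuous_on_inversion) auto
  with 0 show ?case by (auto intro!: continuous_on_compose2[of S \<phi> "inversion ` S" inversion])
next
  case (Suc k)
  have op: "open (inversion ` S)" "0 \<notin> inversion ` S"
    using assms by (auto intro: open_inversion_image)
  show ?case
  proof (rule Ck_on_SucI[OF op(1)])
    fix \<xi> assume \<xi>: "\<xi> \<in> inversion ` S"
    let ?D = "frechet_derivative \<phi> (at (inversion \<xi>))"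
    have D: "(\<phi> has_derivative ?D) (at (inversion \<xi>))"
      using Suc.prems \<xi> by (intro Ck_on_SucD(1)) (auto simp: mem_inversion_image_iff)
    have "?D w = (\<Sum>i\<in>UNIV. w $ i * ?D (axis i 1))" for w
      by (rule linear_expansion) (rule has_derivative_linear[OF D])
    then have eq: "(\<lambda>v. ?D (inversion_derivative \<xi> v)) =
        (\<lambda>v. \<Sum>i\<in>UNIV. inversion_derivative \<xi> v $ i * ?D (axis i 1))"
      by (intro ext)
    have "\<xi> \<noteq> 0" using \<xi> op(2) by auto
    then show "((\<lambda>x. \<phi> (inversion x)) has_derivative
        (\<lambda>v. \<Sum>i\<in>UNIV. inversion_derivative \<xi> v $ i * ?D (axis i 1))) (at \<xi>)"
      unfolding eq[symmetric] by (rule has_derivative_comp_inversion[OF D])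
  next
    show "Ck_on k (inversion ` S) (\<lambda>\<xi>. \<Sum>i\<in>UNIV. inversion_derivative \<xi> v $ i *
        frechet_derivative \<phi> (at (inversion \<xi>)) (axis i 1))" for v
      by (intro Ck_on_sum Ck_on_mult Ck_on_inversion_derivative op Suc.IH
            Ck_on_SucD(2)[OF Suc.prems])
  qed
qed

lemma smooth_fun_on_comp_inversion:
  fixes \<phi> :: "real^'n \<Rightarrow> real"
  assumes "open S" "0 \<notin> S" "smooth_fun_on S \<phi>"
  shows "smooth_fun_on (inversion ` S) (\<lambda>\<xi>. \<phi> (inversion \<xi>))"
  using assms by (simp add: smooth_fun_on_def Ck_on_comp_inversion)

lemma smooth_fun_on_imp_differentiable: "smooth_fun_on S \<phi> \<Longrightarrow> x \<in> S \<Longrightarrow> \<phi> differentiable (at x)"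
  unfolding smooth_fun_on_def using Ck_on.simps(2) by blast

lemma inner_gradient:
  assumes "(\<phi> has_derivative D) (at x)"
  shows "gradient \<phi> x \<bullet> h = D h"
proof -
  have "D h = (\<Sum>i\<in>UNIV. h $ i * D (axis i 1))"
    by (rule linear_expansion) (rule has_derivative_linear[OF assms])
  also have "\<dots> = gradient \<phi> x \<bullet> h"
    unfolding gradient_def frechet_derivative_at[OF assms, symmetric]
    by (simp add: inner_vec_def mult.commute)
  finally show ?thesis by simp
qed

lemma gradient_comp_inversion:
  assumes "\<phi> differentiable (at (inversion \<xi>))" "\<xi> \<noteq> 0"
  shows "gradient (\<lambda>x. \<phi> (inversion x)) \<xi> = inversion_derivative \<xi> (gradient \<phi> (inversion \<xi>))"
proof -
  obtain D where D: "(\<phi> has_derivative D) (at (inversion \<xi>))"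
    using assms(1) by (auto simp: differentiable_def)
  have "gradient (\<lambda>x. \<phi> (inversion x)) \<xi> \<bullet> h = inversion_derivative \<xi> (gradient \<phi> (inversion \<xi>)) \<bullet> h" for h
    by (simp add: inner_gradient[OF has_derivative_comp_inversion[OF D assms(2)]]
        inversion_derivative_selfadjoint inner_gradient[OF D])
  then show ?thesis by (metis vector_eq_rdot)
qed

text \<open>The supports correspond because they are compact and avoid the origin. Smoothness on the whole space
  uses that the composite vanishes near \<open>0\<close>, where the inversion itself is not differentiable.\<close>

lemma test_functions_comp_inversion:
  fixes V :: "(real^'n) set"
  assumes "\<phi> \<in> test_functions V" "0 \<notin> V"
  shows "(\<lambda>\<xi>. \<phi> (inversion \<xi>)) \<in> test_functions (inversion ` V)"
proof -
  let ?\<psi> = "\<lambda>\<xi>. \<phi> (inversion \<xi>)"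
  let ?N = "{x. \<phi> x \<noteq> 0}"
  have smooth: "smooth_fun_on UNIV \<phi>" and cc: "compactly_contained ?N V"
    using assms by (auto simp: test_functions_def)
  have eq: "{\<xi>. ?\<psi> \<xi> \<noteq> 0} = inversion ` ?N"
    by (auto simp: mem_inversion_image_iff)
  have cc': "compactly_contained {\<xi>. ?\<psi> \<xi> \<noteq> 0} (inversion ` V)"
    unfolding eq by (rule compactly_contained_inversion_image[OF cc assms(2)])
  \<comment> \<open>Away from \<open>0\<close> the composite is smooth by the chain rule, and on the neighbourhood \<open>Z\<close> of \<open>0\<close>
    it vanishes.\<close>
  define Z where "Z = - closure {\<xi>. ?\<psi> \<xi> \<noteq> 0}"
  have "open Z" by (simp add: Z_def open_Compl)
  have "0 \<in> Z"
    using cc' assms(2) by (auto simp: Z_def compactly_contained_def)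
  have "Ck_on k UNIV ?\<psi>" for k
  proof -
    have "Ck_on k (- {0}) \<phi>"
      using smooth Ck_on_subset[of k UNIV \<phi>] by (simp add: smooth_fun_on_def)
    then have "Ck_on k (inversion ` (- {0})) ?\<psi>"
      by (intro Ck_on_comp_inversion) auto
    moreover have "inversion ` (- {0}) = - {0 :: real^'n}"
      by (auto simp: mem_inversion_image_iff)
    ultimately have 1: "Ck_on k (- {0}) ?\<psi>" by simp
    have "?\<psi> \<xi> = 0" if "\<xi> \<in> Z" for \<xi>
      using that closure_subset[of "{\<xi>. ?\<psi> \<xi> \<noteq> 0}"] by (auto simp: Z_def)
    then have "Ck_on k Z ?\<psi>"
      using Ck_on_cong[OF \<open>open Z\<close>, of ?\<psi> "\<lambda>_. 0" k] Ck_on_const[OF \<open>open Z\<close>] by auto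
    then have "Ck_on k (- {0} \<union> Z) ?\<psi>"
      by (intro Ck_on_Un 1 \<open>open Z\<close>) auto
    moreover have "- {0} \<union> Z = UNIV" using \<open>0 \<in> Z\<close> by auto
    ultimately show ?thesis by simp
  qed
  then show ?thesis using cc' by (simp add: test_functions_def smooth_fun_on_def)
qed

section \<open>Weighted Lebesgue and Sobolev spaces\<close>

text \<open>The passage from a weight \<open>\<omega>\<close> to the weight \<open>\<omega>'\<close> for which the energies \<open>|\<nabla>u|\<^sup>p \<omega> dx\<close> and
  \<open>|\<nabla>(u \<circ> inversion)|\<^sup>p \<omega>' d\<xi>\<close> agree. As a relation between the values off the origin it is symmetric.\<close>

definition inversion_weights ::
    "real \<Rightarrow> (real^'n \<Rightarrow> real) \<Rightarrow> (real^'n \<Rightarrow> real) \<Rightarrow> bool" where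
  "inversion_weights p \<omega> \<omega>' \<longleftrightarrow>
     (\<forall>\<xi>. \<xi> \<noteq> 0 \<longrightarrow> 0 \<le> \<omega> \<xi> \<and> \<omega>' \<xi> = norm \<xi> powr (2 * (p - real CARD('n))) * \<omega> (inversion \<xi>))"

text \<open>The second part separates the Jacobian of the change of variables from the factor \<open>norm \<xi> powr (2 * p)\<close>
  that gradients absorb and that functions have to be compared with.\<close>

lemma inversion_weightsD:
  fixes \<xi> :: "real^'n"
  assumes "inversion_weights p \<omega> \<omega>'" "\<xi> \<noteq> 0"
  shows "0 \<le> \<omega> \<xi>"
    and "\<omega>' \<xi> = norm \<xi> powr (2 * p) * (\<omega> (inversion \<xi>) / norm \<xi> ^ (2 * CARD('n)))"
proof -
  have "norm \<xi> powr (2 * (p - real CARD('n))) = norm \<xi> powr (2 * p) / norm \<xi> powr (real (2 * CARD('n)))"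
    by (simp add: powr_diff algebra_simps)
  also have "norm \<xi> powr (real (2 * CARD('n))) = norm \<xi> ^ (2 * CARD('n))"
    using assms(2) by (subst powr_realpow) auto
  finally show "\<omega>' \<xi> = norm \<xi> powr (2 * p) * (\<omega> (inversion \<xi>) / norm \<xi> ^ (2 * CARD('n)))"
    using assms by (simp add: inversion_weights_def)
qed (use assms in \<open>simp add: inversion_weights_def\<close>)

lemma inversion_weights_sym:
  fixes \<omega> :: "real^'n \<Rightarrow> real"
  assumes "inversion_weights p \<omega> \<omega>'"
  shows "inversion_weights p \<omega>' \<omega>"
  unfolding inversion_weights_def
proof (intro allI impI conjI)
  fix \<xi> :: "real^'n" assume \<xi>: "\<xi> \<noteq> 0"
  show "0 \<le> \<omega>' \<xi>"
    using assms \<xi> by (simp add: inversion_weights_def)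
  have "norm \<xi> powr a * norm (inversion \<xi>) powr a = 1" for a
    using \<xi> by (simp add: norm_inversion flip: powr_mult)
  then show "\<omega> \<xi> = norm \<xi> powr (2 * (p - real CARD('n))) * \<omega>' (inversion \<xi>)"
    using assms \<xi> by (simp add: inversion_weights_def flip: mult.assoc)
qed

text \<open>The inversion is its own inverse, and differentiable maps send Lebesgue measurable sets to such sets.\<close>

lemma measurable_inversion: "(inversion :: real^'n \<Rightarrow> real^'n) \<in> lebesgue \<rightarrow>\<^sub>M lebesgue"
proof (rule measurableI)
  fix S :: "(real^'n) set"
  assume S: "S \<in> sets lebesgue"
  have "inversion differentiable_on (S - {0})"
    unfolding differentiable_on_def differentiable_def using inversion_has_derivative by blast
  with S have "inversion ` (S - {0}) \<in> sets lebesgue"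
    by (intro differentiable_image_in_sets_lebesgue) auto
  moreover have "inversion -` S = inversion ` (S - {0}) \<union> (S \<inter> {0})"
    by (auto simp: mem_inversion_image_iff)
  moreover have "S \<inter> {0} \<in> sets lebesgue"
    by (cases "0 \<in> S") auto
  ultimately show "inversion -` S \<inter> space lebesgue \<in> sets lebesgue"
    by simp
qed simp

lemma indicator_inversion_image: "indicator (inversion ` G) \<xi> = indicator G (inversion \<xi>)"
  by (simp add: indicator_def mem_inversion_image_iff)

lemma set_borel_measurable_comp_inversion:
  assumes "set_borel_measurable lebesgue G u"
  shows "set_borel_measurable lebesgue (inversion ` G) (\<lambda>\<xi>. u (inversion \<xi>))"
  using measurable_compose[OF measurable_inversion assms[unfolded set_borel_measurable_def]]
  by (simp add: set_borel_measurable_def indicator_inversion_image)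

text \<open>The field that becomes the gradient of \<open>u \<circ> inversion\<close> when \<open>v\<close> is the gradient of \<open>u\<close>.\<close>

definition pullback_field :: "(real^'n \<Rightarrow> real^'n) \<Rightarrow> real^'n \<Rightarrow> real^'n" where
  "pullback_field v \<xi> = inversion_derivative \<xi> (v (inversion \<xi>))"

lemma set_borel_measurable_pullback_field:
  assumes "set_borel_measurable lebesgue G v"
  shows "set_borel_measurable lebesgue (inversion ` G) (pullback_field v)"
proof -
  let ?g = "\<lambda>\<xi>. indicat_real (inversion ` G) \<xi> *\<^sub>R v (inversion \<xi>)"
  have [measurable]: "?g \<in> borel_measurable lebesgue"
    using set_borel_measurable_comp_inversion[OF assms] by (simp add: set_borel_measurable_def)
  have [measurable]: "(\<lambda>\<xi>::real^'n. \<xi>) \<in> borel_measurable lebesgue"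
    by (rule measurable_completion) simp
  have "(\<lambda>\<xi>. inversion_derivative \<xi> (?g \<xi>)) \<in> borel_measurable lebesgue"
    unfolding inversion_derivative_def by measurable
  then show ?thesis
    by (simp add: set_borel_measurable_def pullback_field_def linear_cmul[OF linear_inversion_derivative])
qed

lemma set_integral_nonneg:
  fixes f :: "'a \<Rightarrow> real"
  assumes "\<And>x. x \<in> S \<Longrightarrow> 0 \<le> f x"
  shows "0 \<le> (LINT x:S|M. f x)"
  unfolding set_lebesgue_integral_def
  by (intro Bochner_Integration.integral_nonneg) (simp add: assms indicator_def)

lemma set_integral_inversion_bound:
  fixes h \<kappa> :: "real^'n \<Rightarrow> real"
  assumes "open G" "0 \<notin> G" and h: "set_integrable lebesgue G h" "\<And>x. x \<in> G \<Longrightarrow> 0 \<le> h x"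
    and \<kappa>: "\<kappa> \<in> borel_measurable lebesgue" "\<And>\<xi>. \<xi> \<in> inversion ` G \<Longrightarrow> 0 \<le> \<kappa> \<xi> \<and> \<kappa> \<xi> \<le> M"
  defines "F \<equiv> \<lambda>\<xi>. \<kappa> \<xi> * (h (inversion \<xi>) / norm \<xi> ^ (2 * CARD('n)))"
  shows "set_integrable lebesgue (inversion ` G) F"
    and "(LINT \<xi>:inversion ` G|lebesgue. F \<xi>) \<le> M * (LINT x:G|lebesgue. h x)"
proof -
  let ?S = "inversion ` G"
  \<comment> \<open>The change of variables turns the integral of \<open>h\<close> into that of \<open>?k\<close>, which \<open>F\<close> exceeds by at most
    the factor \<open>M\<close>.\<close>
  let ?k = "\<lambda>\<xi>. h (inversion \<xi>) / norm \<xi> ^ (2 * CARD('n))"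
  have S: "?S \<in> sets lebesgue"
    using open_inversion_image[OF assms(1,2)] by (intro borel_open sets_completionI_sets) auto
  have k: "set_integrable lebesgue ?S ?k" "(LINT \<xi>:?S|lebesgue. ?k \<xi>) = (LINT x:G|lebesgue. h x)"
    using set_integrable_inversion[OF assms(2)] set_integral_inversion[OF assms(2)] h(1) by auto
  have k0: "0 \<le> ?k \<xi>" if "\<xi> \<in> ?S" for \<xi>
    using that h(2) by (auto simp: mem_inversion_image_iff)
  have Mk: "set_integrable lebesgue ?S (\<lambda>\<xi>. M * ?k \<xi>)"
    using k(1) by (rule set_integrable_mult_right)
  have le: "F \<xi> \<le> M * ?k \<xi>" if "\<xi> \<in> ?S" for \<xi>
    unfolding F_def by (rule mult_right_mono) (use \<kappa>(2)[OF that] k0[OF that] in auto)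
  have F0: "0 \<le> F \<xi>" if "\<xi> \<in> ?S" for \<xi>
    unfolding F_def by (rule mult_nonneg_nonneg) (use \<kappa>(2)[OF that] k0[OF that] in auto)
  have F_eq: "(\<lambda>\<xi>. indicator ?S \<xi> *\<^sub>R F \<xi>) = (\<lambda>\<xi>. \<kappa> \<xi> * (indicator ?S \<xi> *\<^sub>R ?k \<xi>))"
    by (simp add: F_def fun_eq_iff mult.left_commute)
  have F: "set_borel_measurable lebesgue ?S F"
    unfolding set_borel_measurable_def F_eq
    by (rule borel_measurable_times[OF \<kappa>(1) borel_measurable_integrable[OF k(1)[unfolded set_integrable_def]]])
  have "norm (F \<xi>) \<le> norm (M * ?k \<xi>)" if "\<xi> \<in> ?S" for \<xi>
    using le[OF that] F0[OF that] by (simp only: real_norm_def)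
  then have "AE \<xi> in lebesgue. \<xi> \<in> ?S \<longrightarrow> norm (F \<xi>) \<le> norm (M * ?k \<xi>)"
    by (intro AE_I2 impI)
  then show int: "set_integrable lebesgue ?S F"
    by (rule set_integrable_bound[OF Mk F])
  have "(LINT \<xi>:?S|lebesgue. F \<xi>) \<le> (LINT \<xi>:?S|lebesgue. M * ?k \<xi>)"
    by (rule set_integral_mono[OF int Mk le])
  then show "(LINT \<xi>:?S|lebesgue. F \<xi>) \<le> M * (LINT x:G|lebesgue. h x)"
    by (simp only: set_integral_mult_right k(2))
qed

text \<open>The common part of the estimates for functions and for vector fields. The factor \<open>\<kappa>\<close> measures by how
  much the transported density differs from the one given by the change of variables.\<close>

lemma Lp_inversion_bound:
  fixes u :: "real^'n \<Rightarrow> 'b::euclidean_space" and u' :: "real^'n \<Rightarrow> 'c::euclidean_space"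
  assumes "0 < p" "open G" "0 \<notin> G" and \<omega>: "\<And>x. x \<in> G \<Longrightarrow> 0 \<le> \<omega> x" and u: "u \<in> Lp p \<omega> G"
    and u': "set_borel_measurable lebesgue (inversion ` G) u'"
    and \<kappa>: "\<kappa> \<in> borel_measurable lebesgue" "\<And>\<xi>. \<xi> \<in> inversion ` G \<Longrightarrow> 0 \<le> \<kappa> \<xi> \<and> \<kappa> \<xi> \<le> M"
    and eq: "\<And>\<xi>. \<xi> \<in> inversion ` G \<Longrightarrow> norm (u' \<xi>) powr p * \<omega>' \<xi> =
       \<kappa> \<xi> * (norm (u (inversion \<xi>)) powr p * \<omega> (inversion \<xi>) / norm \<xi> ^ (2 * CARD('n)))"
  shows "u' \<in> Lp p \<omega>' (inversion ` G)"
    and "Lp_norm p \<omega>' (inversion ` G) u' \<le> \<bar>M\<bar> powr (1 / p) * Lp_norm p \<omega> G u"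
proof -
  let ?h = "\<lambda>x. norm (u x) powr p * \<omega> x"
  let ?F = "\<lambda>\<xi>. \<kappa> \<xi> * (?h (inversion \<xi>) / norm \<xi> ^ (2 * CARD('n)))"
  have h: "set_integrable lebesgue G ?h"
    using u by (simp add: Lp_def)
  have h0: "0 \<le> ?h x" if "x \<in> G" for x using \<omega>[OF that] by simp
  note B = set_integral_inversion_bound[OF assms(2,3) h h0 \<kappa>]
  have J0: "0 \<le> (LINT x:G|lebesgue. ?h x)"
    by (rule set_integral_nonneg) (rule h0)
  have S: "inversion ` G \<in> sets lebesgue"
    using open_inversion_image[OF assms(2,3)] by (intro borel_open sets_completionI_sets) auto
  have "set_integrable lebesgue (inversion ` G) (\<lambda>\<xi>. norm (u' \<xi>) powr p * \<omega>' \<xi>)"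
    using B(1) by (rule set_integrable_cong[THEN iffD1, rotated -1]) (simp_all add: eq)
  with u' show "u' \<in> Lp p \<omega>' (inversion ` G)"
    by (simp add: Lp_def)
  have "(LINT \<xi>:inversion ` G|lebesgue. norm (u' \<xi>) powr p * \<omega>' \<xi>) = (LINT \<xi>:inversion ` G|lebesgue. ?F \<xi>)"
    by (rule set_lebesgue_integral_cong[OF S]) (simp add: eq)
  also have "\<dots> \<le> M * (LINT x:G|lebesgue. ?h x)"
    by (rule B(2))
  also have "\<dots> \<le> \<bar>M\<bar> * (LINT x:G|lebesgue. ?h x)"
    using J0 by (intro mult_right_mono) auto
  finally have le: "(LINT \<xi>:inversion ` G|lebesgue. norm (u' \<xi>) powr p * \<omega>' \<xi>) \<le> \<bar>M\<bar> * (LINT x:G|lebesgue. ?h x)" .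
  have "0 \<le> (LINT \<xi>:inversion ` G|lebesgue. norm (u' \<xi>) powr p * \<omega>' \<xi>)"
  proof (rule set_integral_nonneg)
    fix \<xi> assume \<xi>: "\<xi> \<in> inversion ` G"
    then have "0 \<le> ?h (inversion \<xi>)" by (intro h0) (simp add: mem_inversion_image_iff)
    then show "0 \<le> norm (u' \<xi>) powr p * \<omega>' \<xi>"
      unfolding eq[OF \<xi>] using \<kappa>(2)[OF \<xi>]
      by (intro mult_nonneg_nonneg[of "\<kappa> \<xi>"] divide_nonneg_nonneg) simp_all
  qed
  then have "Lp_norm p \<omega>' (inversion ` G) u' \<le> (\<bar>M\<bar> * (LINT x:G|lebesgue. ?h x)) powr (1 / p)"
    unfolding Lp_norm_def using \<open>0 < p\<close> le by (intro powr_mono2) auto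
  also have "\<dots> = \<bar>M\<bar> powr (1 / p) * Lp_norm p \<omega> G u"
    unfolding Lp_norm_def by (rule powr_mult)
  finally show "Lp_norm p \<omega>' (inversion ` G) u' \<le> \<bar>M\<bar> powr (1 / p) * Lp_norm p \<omega> G u" .
qed

text \<open>For functions the factor is \<open>norm \<xi> powr (2 * p)\<close>, which is bounded because the inverted set is. The
  constant \<open>K\<close> does not depend on the function, so convergence is preserved.\<close>

lemma Lp_comp_inversion:
  fixes \<omega> \<omega>' :: "real^'n \<Rightarrow> real"
  assumes "0 < p" "open G" "0 \<notin> G" "bounded (inversion ` G)" "inversion_weights p \<omega> \<omega>'"
  obtains K where
    "\<And>u::real^'n \<Rightarrow> 'b::euclidean_space. u \<in> Lp p \<omega> G \<Longrightarrow> (\<lambda>\<xi>. u (inversion \<xi>)) \<in> Lp p \<omega>' (inversion ` G)"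
    "\<And>u::real^'n \<Rightarrow> 'b::euclidean_space. u \<in> Lp p \<omega> G \<Longrightarrow>
       Lp_norm p \<omega>' (inversion ` G) (\<lambda>\<xi>. u (inversion \<xi>)) \<le> K * Lp_norm p \<omega> G u"
proof -
  obtain R where R: "\<forall>\<xi>\<in>inversion ` G. norm \<xi> \<le> R"
    using assms(4) unfolding bounded_iff by (elim exE)
  let ?\<kappa> = "\<lambda>\<xi>::real^'n. norm \<xi> powr (2 * p)"
  have nz: "\<xi> \<noteq> 0" if "\<xi> \<in> inversion ` G" for \<xi> using that assms(3) by auto
  have \<omega>: "0 \<le> \<omega> x" if "x \<in> G" for x
  proof (rule inversion_weightsD(1)[OF assms(5)])
    show "x \<noteq> 0" using that assms(3) by auto
  qed
  have \<kappa>: "?\<kappa> \<in> borel_measurable lebesgue"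
    by (rule measurable_completion) measurable
  have \<kappa>R: "0 \<le> ?\<kappa> \<xi> \<and> ?\<kappa> \<xi> \<le> R powr (2 * p)" if "\<xi> \<in> inversion ` G" for \<xi>
    using bspec[OF R that] \<open>0 < p\<close> by (simp add: powr_mono2)
  have eq: "norm (u (inversion \<xi>)) powr p * \<omega>' \<xi> =
       ?\<kappa> \<xi> * (norm (u (inversion \<xi>)) powr p * \<omega> (inversion \<xi>) / norm \<xi> ^ (2 * CARD('n)))"
    if "\<xi> \<in> inversion ` G" for \<xi> and u :: "real^'n \<Rightarrow> 'b"
    using inversion_weightsD(2)[OF assms(5) nz[OF that]] by simp
  have meas: "set_borel_measurable lebesgue (inversion ` G) (\<lambda>\<xi>. u (inversion \<xi>))"
    if "u \<in> Lp p \<omega> G" for u :: "real^'n \<Rightarrow> 'b"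
    using that by (intro set_borel_measurable_comp_inversion) (simp add: Lp_def)
  show thesis
  proof (rule that[of "\<bar>R powr (2 * p)\<bar> powr (1 / p)"])
    fix u :: "real^'n \<Rightarrow> 'b"
    assume u: "u \<in> Lp p \<omega> G"
    show "(\<lambda>\<xi>. u (inversion \<xi>)) \<in> Lp p \<omega>' (inversion ` G)"
      by (rule Lp_inversion_bound(1)[OF assms(1-3) \<omega> u meas[OF u] \<kappa> \<kappa>R eq[where u = u]])
    show "Lp_norm p \<omega>' (inversion ` G) (\<lambda>\<xi>. u (inversion \<xi>)) \<le>
        \<bar>R powr (2 * p)\<bar> powr (1 / p) * Lp_norm p \<omega> G u"
      by (rule Lp_inversion_bound(2)[OF assms(1-3) \<omega> u meas[OF u] \<kappa> \<kappa>R eq[where u = u]])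
  qed
qed

text \<open>For fields transported as gradients the factor is \<open>1\<close>: this conformal invariance of the energy is what
  the exponent of the weight is made for.\<close>

lemma Lp_pullback_field:
  fixes \<omega> \<omega>' :: "real^'n \<Rightarrow> real"
  assumes "0 < p" "open G" "0 \<notin> G" "inversion_weights p \<omega> \<omega>'" "v \<in> Lp p \<omega> G"
  shows "pullback_field v \<in> Lp p \<omega>' (inversion ` G)"
    and "Lp_norm p \<omega>' (inversion ` G) (pullback_field v) \<le> Lp_norm p \<omega> G v"
proof -
  have nz: "\<xi> \<noteq> 0" if "\<xi> \<in> inversion ` G" for \<xi> using that assms(3) by auto
  have \<omega>: "0 \<le> \<omega> x" if "x \<in> G" for x
  proof (rule inversion_weightsD(1)[OF assms(4)])
    show "x \<noteq> 0" using that assms(3) by auto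
  qed
  have meas: "set_borel_measurable lebesgue (inversion ` G) (pullback_field v)"
    using assms(5) by (intro set_borel_measurable_pullback_field) (simp add: Lp_def)
  \<comment> \<open>The factor \<open>norm \<xi> powr (- 2 * p)\<close> from the derivative cancels the excess factor of the weight.\<close>
  have eq: "norm (pullback_field v \<xi>) powr p * \<omega>' \<xi> =
       1 * (norm (v (inversion \<xi>)) powr p * \<omega> (inversion \<xi>) / norm \<xi> ^ (2 * CARD('n)))"
    if "\<xi> \<in> inversion ` G" for \<xi>
  proof -
    have "norm (pullback_field v \<xi>) powr p = norm (v (inversion \<xi>)) powr p / norm \<xi> powr (2 * p)"
      using nz[OF that]
      by (simp add: pullback_field_def norm_inversion_derivative powr_divide powr_powr[of "norm \<xi>" 2 p, symmetric])
    then show ?thesis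
      using inversion_weightsD(2)[OF assms(4) nz[OF that]] nz[OF that] by simp
  qed
  note B = Lp_inversion_bound[OF assms(1-3) \<omega> assms(5) meas _ _ eq, of 1]
  show "pullback_field v \<in> Lp p \<omega>' (inversion ` G)"
    by (rule B(1)) auto
  have "Lp_norm p \<omega>' (inversion ` G) (pullback_field v) \<le> \<bar>1\<bar> powr (1 / p) * Lp_norm p \<omega> G v"
    by (rule B(2)) auto
  then show "Lp_norm p \<omega>' (inversion ` G) (pullback_field v) \<le> Lp_norm p \<omega> G v"
    by simp
qed

lemma indicator_scaleR_cong:
  fixes f g :: "'a \<Rightarrow> 'b::real_vector"
  assumes "\<And>x. x \<in> V \<Longrightarrow> f x = g x"
  shows "(\<lambda>x. indicat_real V x *\<^sub>R f x) = (\<lambda>x. indicator V x *\<^sub>R g x)"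
  using assms by (auto simp: fun_eq_iff indicator_def)

lemma Lp_cong:
  assumes "\<And>x. x \<in> V \<Longrightarrow> f x = g x"
  shows "f \<in> Lp p \<omega> V \<longleftrightarrow> g \<in> Lp p \<omega> V" and "Lp_norm p \<omega> V f = Lp_norm p \<omega> V g"
proof -
  have 1: "(\<lambda>x. indicat_real V x *\<^sub>R f x) = (\<lambda>x. indicator V x *\<^sub>R g x)"
    by (rule indicator_scaleR_cong) (rule assms)
  have 2: "(\<lambda>x. indicat_real V x *\<^sub>R (norm (f x) powr p * \<omega> x)) = (\<lambda>x. indicator V x *\<^sub>R (norm (g x) powr p * \<omega> x))"
    by (rule indicator_scaleR_cong) (simp add: assms)
  show "f \<in> Lp p \<omega> V \<longleftrightarrow> g \<in> Lp p \<omega> V"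
    unfolding Lp_def set_borel_measurable_def set_integrable_def mem_Collect_eq 1 2 by (rule refl)
  show "Lp_norm p \<omega> V f = Lp_norm p \<omega> V g"
    unfolding Lp_norm_def set_lebesgue_integral_def 2 by (rule refl)
qed

lemma Lp_norm_nonneg: "0 \<le> Lp_norm p \<omega> V u"
  by (simp add: Lp_norm_def)

text \<open>A map with a uniform norm bound, under which differences correspond, preserves convergence.\<close>

lemma Lp_converges_transfer:
  fixes f :: "nat \<Rightarrow> 'a::euclidean_space \<Rightarrow> 'b::euclidean_space" and f' :: "nat \<Rightarrow> 'c::euclidean_space \<Rightarrow> 'd::euclidean_space"
  assumes conv: "Lp_converges p \<omega> V f u"
    and mem: "\<And>w. w \<in> Lp p \<omega> V \<Longrightarrow> L w \<in> Lp p \<omega>' V'"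
    and bound: "\<And>w. w \<in> Lp p \<omega> V \<Longrightarrow> Lp_norm p \<omega>' V' (L w) \<le> K * Lp_norm p \<omega> V w"
    and eq: "\<And>j x. x \<in> V' \<Longrightarrow> f' j x - u' x = L (\<lambda>y. f j y - u y) x"
  shows "Lp_converges p \<omega>' V' f' u'"
proof -
  have f: "(\<lambda>x. f j x - u x) \<in> Lp p \<omega> V" for j
    using conv by (simp add: Lp_converges_def)
  have lim: "(\<lambda>j. Lp_norm p \<omega> V (\<lambda>x. f j x - u x)) \<longlonglongrightarrow> 0"
    using conv by (simp add: Lp_converges_def)
  have mem': "(\<lambda>x. f' j x - u' x) \<in> Lp p \<omega>' V'" for j
    using mem[OF f[of j]] Lp_cong(1)[of V' "\<lambda>x. f' j x - u' x" "L (\<lambda>y. f j y - u y)", OF eq] by blast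
  have le: "Lp_norm p \<omega>' V' (\<lambda>x. f' j x - u' x) \<le> K * Lp_norm p \<omega> V (\<lambda>x. f j x - u x)" for j
    using bound[OF f[of j]] Lp_cong(2)[of V' "\<lambda>x. f' j x - u' x" "L (\<lambda>y. f j y - u y)", OF eq] by simp
  have "(\<lambda>j. K * Lp_norm p \<omega> V (\<lambda>x. f j x - u x)) \<longlonglongrightarrow> K * 0"
    by (rule tendsto_mult_left[OF lim])
  then have lim': "(\<lambda>j. K * Lp_norm p \<omega> V (\<lambda>x. f j x - u x)) \<longlonglongrightarrow> 0"
    by simp
  have "(\<lambda>j. Lp_norm p \<omega>' V' (\<lambda>x. f' j x - u' x)) \<longlonglongrightarrow> 0"
    by (rule tendsto_sandwich[OF always_eventually always_eventually tendsto_const lim'])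
       (intro allI Lp_norm_nonneg le)+
  then show ?thesis using mem' by (simp add: Lp_converges_def)
qed

text \<open>Smooth approximants of \<open>u\<close> composed with the inversion approximate the composite, and the chain rule
  identifies their gradients.\<close>

lemma has_Sobolev_gradient_comp_inversion:
  fixes G :: "(real^'n) set"
  assumes "0 < p" "open G" "0 \<notin> G" "bounded (inversion ` G)" "inversion_weights p \<omega> \<omega>'"
    and "has_Sobolev_gradient p \<omega> G u v"
  shows "has_Sobolev_gradient p \<omega>' (inversion ` G) (\<lambda>\<xi>. u (inversion \<xi>)) (pullback_field v)"
proof -
  obtain \<phi> where u: "u \<in> Lp p \<omega> G" and v: "v \<in> Lp p \<omega> G" and \<phi>: "\<And>j. smooth_fun_on G (\<phi> j)"
    and conv: "Lp_converges p \<omega> G \<phi> u" "Lp_converges p \<omega> G (\<lambda>j. gradient (\<phi> j)) v"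
    using assms(6) by (auto simp: has_Sobolev_gradient_def)
  obtain K where K:
    "\<And>u::real^'n \<Rightarrow> real. u \<in> Lp p \<omega> G \<Longrightarrow> (\<lambda>\<xi>. u (inversion \<xi>)) \<in> Lp p \<omega>' (inversion ` G)"
    "\<And>u::real^'n \<Rightarrow> real. u \<in> Lp p \<omega> G \<Longrightarrow>
       Lp_norm p \<omega>' (inversion ` G) (\<lambda>\<xi>. u (inversion \<xi>)) \<le> K * Lp_norm p \<omega> G u"
    using Lp_comp_inversion[OF assms(1-5)] by blast
  let ?\<psi> = "\<lambda>j \<xi>. \<phi> j (inversion \<xi>)"
  have conv_u: "Lp_converges p \<omega>' (inversion ` G) ?\<psi> (\<lambda>\<xi>. u (inversion \<xi>))"
    by (rule Lp_converges_transfer[OF conv(1), where L = "\<lambda>w \<xi>. w (inversion \<xi>)", OF K]) simp_all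
  have conv_v: "Lp_converges p \<omega>' (inversion ` G) (\<lambda>j. gradient (?\<psi> j)) (pullback_field v)"
  proof (rule Lp_converges_transfer[OF conv(2), where L = pullback_field and K = 1])
    fix w :: "real^'n \<Rightarrow> real^'n" assume w: "w \<in> Lp p \<omega> G"
    show "pullback_field w \<in> Lp p \<omega>' (inversion ` G)"
      by (rule Lp_pullback_field(1)[OF assms(1-3,5) w])
    show "Lp_norm p \<omega>' (inversion ` G) (pullback_field w) \<le> 1 * Lp_norm p \<omega> G w"
      using Lp_pullback_field(2)[OF assms(1-3,5) w] by simp
  next
    fix j \<xi> assume \<xi>: "\<xi> \<in> inversion ` G"
    then have "inversion \<xi> \<in> G" by (simp add: mem_inversion_image_iff)
    moreover from \<xi> have "\<xi> \<noteq> 0" using assms(3) by auto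
    ultimately have "gradient (?\<psi> j) \<xi> = inversion_derivative \<xi> (gradient (\<phi> j) (inversion \<xi>))"
      by (intro gradient_comp_inversion smooth_fun_on_imp_differentiable[OF \<phi>])
    then show "gradient (?\<psi> j) \<xi> - pullback_field v \<xi> = pullback_field (\<lambda>y. gradient (\<phi> j) y - v y) \<xi>"
      by (simp add: pullback_field_def linear_diff[OF linear_inversion_derivative])
  qed
  have "\<forall>j. smooth_fun_on (inversion ` G) (?\<psi> j)"
    by (intro allI smooth_fun_on_comp_inversion assms \<phi>)
  with conv_u conv_v K(1)[OF u] Lp_pullback_field(1)[OF assms(1-3,5) v] show ?thesis
    unfolding has_Sobolev_gradient_def by (intro conjI exI[of _ ?\<psi>])
qed

lemma has_local_Sobolev_gradient_comp_inversion:
  fixes V :: "(real^'n) set"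
  assumes "0 < p" "0 \<notin> V" "inversion_weights p \<omega> \<omega>'" "has_local_Sobolev_gradient p \<omega> V u v"
  shows "has_local_Sobolev_gradient p \<omega>' (inversion ` V) (\<lambda>\<xi>. u (inversion \<xi>)) (pullback_field v)"
  unfolding has_local_Sobolev_gradient_def
proof (intro allI impI, elim conjE)
  fix G :: "(real^'n) set"
  assume "open G" "compactly_contained G (inversion ` V)"
  note * = inversion_image_compactly_contained[OF this assms(2)]
  have "has_Sobolev_gradient p \<omega> (inversion ` G) u v"
    using assms(4) *(1,2) by (simp add: has_local_Sobolev_gradient_def)
  from has_Sobolev_gradient_comp_inversion[OF assms(1) *(1,3,4) assms(3) this]
  show "has_Sobolev_gradient p \<omega>' G (\<lambda>\<xi>. u (inversion \<xi>)) (pullback_field v)" by simp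
qed

lemma H1p_loc_comp_inversion:
  fixes V :: "(real^'n) set"
  assumes "0 < p" "0 \<notin> V" "inversion_weights p \<omega> \<omega>'" "u \<in> H1p_loc p \<omega> V"
  shows "(\<lambda>\<xi>. u (inversion \<xi>)) \<in> H1p_loc p \<omega>' (inversion ` V)"
proof -
  have "(\<lambda>\<xi>. u (inversion \<xi>)) \<in> H1p p \<omega>' G"
    if G: "open G" "compactly_contained G (inversion ` V)" for G
  proof -
    note * = inversion_image_compactly_contained[OF G assms(2)]
    obtain v where "has_Sobolev_gradient p \<omega> (inversion ` G) u v"
      using assms(4) *(1,2) by (auto simp: H1p_loc_def H1p_def)
    from has_Sobolev_gradient_comp_inversion[OF assms(1) *(1,3,4) assms(3) this]
    show ?thesis by (auto simp: H1p_def)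
  qed
  moreover then have "(\<lambda>\<xi>. u (inversion \<xi>)) \<in> Lp p \<omega>' G"
    if "open G" "compactly_contained G (inversion ` V)" for G
    using that by (fastforce simp: H1p_def has_Sobolev_gradient_def)
  ultimately show ?thesis by (simp add: H1p_loc_def Lp_loc_def)
qed

section \<open>Harmonic functions\<close>

text \<open>The relation between the data on a domain and on its inversion. Its symmetry allows every transport
  result to be stated as an implication in one direction.\<close>

definition inversion_pair ::
    "real \<Rightarrow> (real^'n \<Rightarrow> real) \<Rightarrow> (real^'n \<Rightarrow> real^'n \<Rightarrow> real^'n) \<Rightarrow>
     (real^'n \<Rightarrow> real) \<Rightarrow> (real^'n \<Rightarrow> real^'n \<Rightarrow> real^'n) \<Rightarrow> bool" where
  "inversion_pair p \<omega> C \<omega>' C' \<longleftrightarrow>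
     inversion_weights p \<omega> \<omega>' \<and> (\<forall>\<xi> q. \<xi> \<noteq> 0 \<longrightarrow> C' \<xi> q = transformed_map C \<xi> q)"

text \<open>The Jacobians at \<open>\<xi>\<close> and at its inverse are reciprocal, and so are the derivatives.\<close>

lemma transformed_map_transformed_map:
  fixes C :: "real^'n \<Rightarrow> real^'n \<Rightarrow> real^'n"
  assumes "\<xi> \<noteq> 0"
  shows "transformed_map (transformed_map C) \<xi> q = C \<xi> q"
proof -
  let ?x = "inversion \<xi>" and ?c = "\<lambda>x::real^'n. inverse (norm x ^ (2 * CARD('n)))"
  have x: "?x \<noteq> 0" using assms by simp
  have cancel: "inversion_derivative \<xi> (inversion_derivative ?x h) = h"
    "inversion_derivative ?x (inversion_derivative \<xi> h) = h" for h
    using inversion_derivative_cancel[OF x] inversion_derivative_cancel[OF assms] by simp_all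
  have "?c \<xi> * ?c ?x = 1"
    using assms by (simp add: norm_inversion power_inverse)
  then show ?thesis
    by (simp add: transformed_map_eq[OF assms] transformed_map_eq[OF x] cancel
        linear_cmul[OF linear_inversion_derivative])
qed

lemma inversion_pair_sym:
  assumes "inversion_pair p \<omega> C \<omega>' C'"
  shows "inversion_pair p \<omega>' C' \<omega> C"
proof -
  have "C \<xi> q = transformed_map C' \<xi> q" if "\<xi> \<noteq> 0" for \<xi> q
  proof -
    have "inversion \<xi> \<noteq> 0" using that by simp
    then have "transformed_map C' \<xi> q = transformed_map (transformed_map C) \<xi> q"
      using assms by (simp add: transformed_map_eq[OF that] inversion_pair_def)
    then show ?thesis using transformed_map_transformed_map[OF that] by simp
  qed
  then show ?thesis
    using assms inversion_weights_sym by (auto simp: inversion_pair_def)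
qed

text \<open>The pointwise identity behind the equivalence of the weak equations: the integrand of the transformed
  equation is that of the original one times the Jacobian.\<close>

lemma inner_transformed_map:
  fixes C :: "real^'n \<Rightarrow> real^'n \<Rightarrow> real^'n"
  assumes "\<xi> \<noteq> 0"
  shows "transformed_map C \<xi> (inversion_derivative \<xi> q) \<bullet> inversion_derivative \<xi> h =
    (C (inversion \<xi>) q \<bullet> h) / norm \<xi> ^ (2 * CARD('n))"
  using assms
  by (simp add: transformed_map_eq inversion_derivative_selfadjoint inversion_derivative_cancel divide_inverse_commute)

text \<open>Test functions, Sobolev gradients and the weak equation all correspond under the inversion.\<close>

lemma C_harmonic_comp_inversion:
  fixes V :: "(real^'n) set"
  assumes "0 < p" "0 \<notin> V" and pair: "inversion_pair p \<omega> C \<omega>' C'" and u: "C_harmonic p \<omega> C V u"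
  shows "C_harmonic p \<omega>' C' (inversion ` V) (\<lambda>\<xi>. u (inversion \<xi>))"
proof -
  obtain v where v: "has_local_Sobolev_gradient p \<omega> V u v"
    and weak: "\<And>\<phi>. \<phi> \<in> test_functions V \<Longrightarrow> set_integrable lebesgue V (\<lambda>x. C x (v x) \<bullet> gradient \<phi> x) \<and>
           (LINT x:V|lebesgue. C x (v x) \<bullet> gradient \<phi> x) = 0"
    using u by (auto simp: C_harmonic_def)
  have W: "inversion_weights p \<omega> \<omega>'" using pair by (simp add: inversion_pair_def)
  have "set_integrable lebesgue (inversion ` V) (\<lambda>\<xi>. C' \<xi> (pullback_field v \<xi>) \<bullet> gradient \<psi> \<xi>) \<and>
      (LINT \<xi>:inversion ` V|lebesgue. C' \<xi> (pullback_field v \<xi>) \<bullet> gradient \<psi> \<xi>) = 0"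
    if \<psi>: "\<psi> \<in> test_functions (inversion ` V)" for \<psi>
  proof -
    define \<phi> where "\<phi> = (\<lambda>x. \<psi> (inversion x))"
    have \<psi>_eq: "\<psi> = (\<lambda>\<xi>. \<phi> (inversion \<xi>))" by (simp add: \<phi>_def)
    have \<phi>: "\<phi> \<in> test_functions V"
      using test_functions_comp_inversion[OF \<psi>] assms(2) by (simp add: \<phi>_def)
    then have diff: "\<phi> differentiable (at x)" for x
      by (intro smooth_fun_on_imp_differentiable[of UNIV]) (simp_all add: test_functions_def)
    let ?F = "\<lambda>x. C x (v x) \<bullet> gradient \<phi> x"
    \<comment> \<open>Both arguments of the inner product carry a derivative of the inversion, and these cancel.\<close>
    have eq: "C' \<xi> (pullback_field v \<xi>) \<bullet> gradient \<psi> \<xi> = ?F (inversion \<xi>) / norm \<xi> ^ (2 * CARD('n))"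
      if "\<xi> \<in> inversion ` V" for \<xi>
    proof -
      have \<xi>: "\<xi> \<noteq> 0" using that assms(2) by auto
      have "C' \<xi> (pullback_field v \<xi>) = transformed_map C \<xi> (inversion_derivative \<xi> (v (inversion \<xi>)))"
        using pair \<xi> by (simp add: inversion_pair_def pullback_field_def)
      moreover have "gradient \<psi> \<xi> = inversion_derivative \<xi> (gradient \<phi> (inversion \<xi>))"
        unfolding \<psi>_eq by (rule gradient_comp_inversion[OF diff \<xi>])
      ultimately show ?thesis
        by (simp only: inner_transformed_map[OF \<xi>])
    qed
    have ind: "(\<lambda>\<xi>. indicat_real (inversion ` V) \<xi> *\<^sub>R (C' \<xi> (pullback_field v \<xi>) \<bullet> gradient \<psi> \<xi>)) =
      (\<lambda>\<xi>. indicator (inversion ` V) \<xi> *\<^sub>R (?F (inversion \<xi>) / norm \<xi> ^ (2 * CARD('n))))"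
      by (rule indicator_scaleR_cong) (rule eq)
    show ?thesis
      using weak[OF \<phi>] set_integrable_inversion[OF assms(2), of ?F] set_integral_inversion[OF assms(2), of ?F]
      unfolding set_integrable_def set_lebesgue_integral_def ind by simp
  qed
  moreover have "has_local_Sobolev_gradient p \<omega>' (inversion ` V) (\<lambda>\<xi>. u (inversion \<xi>)) (pullback_field v)"
    by (rule has_local_Sobolev_gradient_comp_inversion[OF assms(1,2) W v])
  moreover have "(\<lambda>\<xi>. u (inversion \<xi>)) \<in> H1p_loc p \<omega>' (inversion ` V)"
    using u by (intro H1p_loc_comp_inversion[OF assms(1,2) W]) (simp add: C_harmonic_def)
  moreover have "continuous_on (inversion ` V) (\<lambda>\<xi>. u (inversion \<xi>))"
    using u assms(2) by (intro continuous_on_comp_inversion) (simp_all add: C_harmonic_def)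
  ultimately show ?thesis
    unfolding C_harmonic_def by blast
qed

section \<open>The one-point compactification and the extended boundary\<close>

lemma topspace_extended_space [simp]: "topspace extended_space = UNIV"
  by (simp add: extended_space_def) (metis UNIV_option_conv)

text \<open>Neighbourhoods of infinity are the sets with bounded complement, closed and bounded sets being compact.\<close>

lemma openin_extended_space_iff:
  fixes U :: "(real^'n) option set"
  shows "openin extended_space U \<longleftrightarrow>
     open {x. Some x \<in> U} \<and> (None \<in> U \<longrightarrow> bounded {x. Some x \<notin> U})"
proof
  assume "openin extended_space U"
  then consider W where "open W" "U = Some ` W"
    | C where "compact C" "U = insert None (Some ` (- C))"
    by (auto simp: extended_space_def openin_Alexandroff_compactification Compl_eq_Diff_UNIV)
  then show "open {x. Some x \<in> U} \<and> (None \<in> U \<longrightarrow> bounded {x. Some x \<notin> U})"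
  proof cases
    case 1
    then have "{x. Some x \<in> U} = W" "None \<notin> U" by auto
    with 1 show ?thesis by simp
  next
    case 2
    then have "{x. Some x \<in> U} = - C" "{x. Some x \<notin> U} = C" by auto
    with 2 show ?thesis by (simp add: compact_imp_closed compact_imp_bounded open_Compl)
  qed
next
  assume *: "open {x. Some x \<in> U} \<and> (None \<in> U \<longrightarrow> bounded {x. Some x \<notin> U})"
  show "openin extended_space U"
  proof (cases "None \<in> U")
    case True
    define C where "C = {x. Some x \<notin> U}"
    have "C = - {x. Some x \<in> U}" by (auto simp: C_def)
    then have "compact C" using * True by (simp add: compact_eq_bounded_closed closed_Compl C_def)
    moreover have "U = insert None (Some ` (UNIV - C))"
    proof (rule set_eqI)
      fix z show "z \<in> U \<longleftrightarrow> z \<in> insert None (Some ` (UNIV - C))"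
        using True by (cases z) (auto simp: C_def)
    qed
    ultimately show ?thesis
      unfolding extended_space_def openin_Alexandroff_compactification
      by (intro disjI2 exI[of _ C]) (simp add: compact_imp_closed)
  next
    case False
    have "U = Some ` {x. Some x \<in> U}"
    proof (rule set_eqI)
      fix z show "z \<in> U \<longleftrightarrow> z \<in> Some ` {x. Some x \<in> U}"
        using False by (cases z) auto
    qed
    then show ?thesis
      unfolding extended_space_def openin_Alexandroff_compactification
      using * by (intro disjI1 exI[of _ "{x. Some x \<in> U}"]) simp
  qed
qed

lemma extended_inversion_extended_inversion [simp]: "extended_inversion (extended_inversion z) = z"
  by (cases z) auto

lemma extended_inversion_eq_iff: "extended_inversion y = extended_inversion z \<longleftrightarrow> y = z"
  by (metis extended_inversion_extended_inversion)

text \<open>Away from \<open>0\<close> and infinity this is continuity of the inversion. A neighbourhood of infinity contains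
  the exterior of a ball, which the inversion turns into a ball around \<open>0\<close>, and conversely.\<close>

lemma openin_extended_inversion_vimage:
  fixes U :: "(real^'n) option set"
  assumes "openin extended_space U"
  shows "openin extended_space (extended_inversion -` U)"
proof -
  let ?W = "{x. Some x \<in> U}"
  let ?W' = "{x. Some x \<in> extended_inversion -` U}"
  have W: "open ?W" and bd: "None \<in> U \<Longrightarrow> bounded (- ?W)"
    using assms by (simp_all add: openin_extended_space_iff Collect_neg_eq)
  have away: "open (inversion ` (?W - {0}))"
    using W by (intro open_inversion_image) auto
  have mem: "x \<in> ?W' \<longleftrightarrow> inversion x \<in> ?W" if "x \<noteq> 0" for x :: "real^'n"
    using that by simp
  have "open ?W'"
  proof (cases "None \<in> U")
    case True
    then obtain R where R: "R > 0" "\<And>x. x \<notin> ?W \<Longrightarrow> norm x \<le> R"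
      using bd unfolding bounded_pos by auto
    have ball: "ball 0 (inverse R) \<subseteq> ?W'"
    proof
      fix x :: "real^'n" assume "x \<in> ball 0 (inverse R)"
      then have x: "norm x < inverse R" by simp
      show "x \<in> ?W'"
      proof (cases "x = 0")
        case False
        then have "R < norm (inversion x)"
          using less_imp_inverse_less[OF x] by (simp add: norm_inversion)
        then have "inversion x \<in> ?W" using R(2) leD by blast
        then show ?thesis using mem False by blast
      qed (use True in simp)
    qed
    have "x \<in> ?W' \<longleftrightarrow> x \<in> inversion ` (?W - {0}) \<union> ball 0 (inverse R)" for x :: "real^'n"
    proof (cases "x = 0")
      case True
      then show ?thesis using \<open>None \<in> U\<close> R(1) by simp
    next
      case False
      then show ?thesis using mem[OF False] subsetD[OF ball, of x] by (auto simp: mem_inversion_image_iff)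
    qed
    then have "?W' = inversion ` (?W - {0}) \<union> ball 0 (inverse R)" by blast
    then show ?thesis using away by (simp only: open_Un open_ball)
  next
    case False
    have "x \<in> ?W' \<longleftrightarrow> x \<in> inversion ` (?W - {0})" for x :: "real^'n"
      using False by (cases "x = 0") (simp_all add: mem_inversion_image_iff)
    then have "?W' = inversion ` (?W - {0})" by blast
    then show ?thesis using away by simp
  qed
  moreover have "bounded (- ?W')" if "None \<in> extended_inversion -` U"
  proof -
    have "0 \<in> ?W" using that by simp
    then obtain e where e: "e > 0" "ball 0 e \<subseteq> ?W"
      using W open_contains_ball by metis
    have "norm x \<le> inverse e" if "x \<notin> ?W'" for x :: "real^'n"
    proof (cases "x = 0")
      case False
      then have "inversion x \<notin> ball 0 e" using mem[OF False] that e(2) by blast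
      then have "e \<le> inverse (norm x)" by (simp add: norm_inversion)
      then show ?thesis using le_imp_inverse_le[OF _ e(1)] by fastforce
    qed (use e in simp)
    then show ?thesis unfolding bounded_iff by blast
  qed
  ultimately show ?thesis
    by (simp add: openin_extended_space_iff Collect_neg_eq)
qed

lemma continuous_map_extended_inversion:
  "continuous_map extended_space extended_space (extended_inversion :: (real^'n) option \<Rightarrow> _)"
  using openin_extended_inversion_vimage by (auto simp: continuous_map_def vimage_def)

text \<open>For an open set the extended boundary is the boundary in the one-point compactification, a topological
  notion that homeomorphisms of the compactification preserve.\<close>

lemma mem_extended_boundary_iff:
  fixes V :: "(real^'n) set"
  assumes "open V"
  shows "z \<in> extended_boundary V \<longleftrightarrow>
    z \<notin> Some ` V \<and> (\<forall>U. openin extended_space U \<and> z \<in> U \<longrightarrow> (\<exists>x\<in>V. Some x \<in> U))"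
proof (cases z)
  case None
  have "\<not> bounded V \<longleftrightarrow> (\<forall>U. openin extended_space U \<and> None \<in> U \<longrightarrow> (\<exists>x\<in>V. Some x \<in> U))"
  proof
    assume V: "\<not> bounded V"
    show "\<forall>U. openin extended_space U \<and> None \<in> U \<longrightarrow> (\<exists>x\<in>V. Some x \<in> U)"
    proof (intro allI impI, rule ccontr)
      fix U :: "(real^'n) option set"
      assume U: "openin extended_space U \<and> None \<in> U" and "\<not> (\<exists>x\<in>V. Some x \<in> U)"
      then have "V \<subseteq> {x. Some x \<notin> U}" by blast
      moreover have "bounded {x. Some x \<notin> U}" using U by (simp add: openin_extended_space_iff)
      ultimately show False using V bounded_subset by blast
    qed
  next
    assume *: "\<forall>U. openin extended_space U \<and> None \<in> U \<longrightarrow> (\<exists>x\<in>V. Some x \<in> U)"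
    show "\<not> bounded V"
    proof
      assume "bounded V"
      \<comment> \<open>If \<open>V\<close> is bounded, the complement of its closure is a neighbourhood of infinity that misses \<open>V\<close>.\<close>
      let ?U = "insert None (Some ` (- closure V))"
      have "{x. Some x \<in> ?U} = - closure V" "{x. Some x \<notin> ?U} = closure V" by auto
      then have "openin extended_space ?U"
        using \<open>bounded V\<close> by (simp add: openin_extended_space_iff open_Compl bounded_closure)
      then obtain x where "x \<in> V" "Some x \<in> ?U" using * by blast
      then show False using closure_subset by auto
    qed
  qed
  then show ?thesis using None by (auto simp: extended_boundary_def)
next
  case (Some y)
  have "y \<in> closure V \<longleftrightarrow> (\<forall>U. openin extended_space U \<and> Some y \<in> U \<longrightarrow> (\<exists>x\<in>V. Some x \<in> U))"
  proof
    assume y: "y \<in> closure V"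
    show "\<forall>U. openin extended_space U \<and> Some y \<in> U \<longrightarrow> (\<exists>x\<in>V. Some x \<in> U)"
    proof (intro allI impI)
      fix U :: "(real^'n) option set"
      assume U: "openin extended_space U \<and> Some y \<in> U"
      then have "open {x. Some x \<in> U}" "y \<in> {x. Some x \<in> U}"
        by (simp_all add: openin_extended_space_iff)
      with y have "V \<inter> {x. Some x \<in> U} \<noteq> {}"
        using open_Int_closure_eq_empty by (metis Int_commute disjoint_iff)
      then show "\<exists>x\<in>V. Some x \<in> U" by blast
    qed
  next
    assume *: "\<forall>U. openin extended_space U \<and> Some y \<in> U \<longrightarrow> (\<exists>x\<in>V. Some x \<in> U)"
    show "y \<in> closure V"
    proof (rule ccontr)
      assume "y \<notin> closure V"
      let ?U = "Some ` (- closure V)"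
      have "{x. Some x \<in> ?U} = - closure V" by auto
      then have "openin extended_space ?U"
        by (auto simp add: openin_extended_space_iff)
      moreover have "Some y \<in> ?U" using \<open>y \<notin> closure V\<close> by simp
      ultimately obtain x where "x \<in> V" "Some x \<in> ?U" using * by blast
      then show False using closure_subset by auto
    qed
  qed
  then show ?thesis
    using Some assms by (auto simp: extended_boundary_def frontier_def interior_open)
qed

lemma extended_inversion_Some:
  assumes "x \<in> V" "0 \<notin> V"
  shows "extended_inversion (Some x) = Some (inversion x)"
  using assms by auto

lemma extended_inversion_mem_extended_boundary:
  fixes V :: "(real^'n) set"
  assumes "open V" "0 \<notin> V" "z \<in> extended_boundary V"
  shows "extended_inversion z \<in> extended_boundary (inversion ` V)"
  unfolding mem_extended_boundary_iff[OF open_inversion_image[OF assms(1,2)]]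
proof (intro conjI allI impI)
  have z: "z \<notin> Some ` V" "\<And>U. openin extended_space U \<Longrightarrow> z \<in> U \<Longrightarrow> \<exists>x\<in>V. Some x \<in> U"
    using assms(3) unfolding mem_extended_boundary_iff[OF assms(1)] by blast+
  show "extended_inversion z \<notin> Some ` inversion ` V"
  proof
    assume "extended_inversion z \<in> Some ` inversion ` V"
    then obtain x where x: "x \<in> V" "extended_inversion z = Some (inversion x)" by blast
    then have "extended_inversion z = extended_inversion (Some x)"
      using extended_inversion_Some[OF x(1) assms(2)] by simp
    then have "z = Some x" by (simp only: extended_inversion_eq_iff)
    then show False using z(1) x(1) by blast
  qed
  fix U assume U: "openin extended_space U \<and> extended_inversion z \<in> U"
  then obtain x where x: "x \<in> V" "Some x \<in> extended_inversion -` U"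
    using z(2)[of "extended_inversion -` U"] openin_extended_inversion_vimage by blast
  then have "Some (inversion x) \<in> U"
    using extended_inversion_Some[OF x(1) assms(2)] by simp
  then show "\<exists>\<xi>\<in>inversion ` V. Some \<xi> \<in> U" using x(1) by blast
qed

lemma eventually_approach_iff:
  "eventually P (approach V z) \<longleftrightarrow>
    (\<exists>U. openin extended_space U \<and> z \<in> U \<and> (\<forall>x\<in>V. Some x \<in> U \<and> Some x \<noteq> z \<longrightarrow> P x))"
proof
  assume "eventually P (approach V z)"
  then obtain Q where Q: "eventually Q (atin_within extended_space z (Some ` V))" "\<And>x. Q (Some x) \<Longrightarrow> P x"
    unfolding approach_def eventually_filtercomap by blast
  then obtain U where "openin extended_space U" "z \<in> U" "\<forall>y\<in>U. y \<in> Some ` V \<and> y \<noteq> z \<longrightarrow> Q y"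
    unfolding eventually_atin_within by auto
  with Q(2) show "\<exists>U. openin extended_space U \<and> z \<in> U \<and> (\<forall>x\<in>V. Some x \<in> U \<and> Some x \<noteq> z \<longrightarrow> P x)"
    by blast
next
  assume "\<exists>U. openin extended_space U \<and> z \<in> U \<and> (\<forall>x\<in>V. Some x \<in> U \<and> Some x \<noteq> z \<longrightarrow> P x)"
  then obtain U where U: "openin extended_space U" "z \<in> U" "\<And>x. x \<in> V \<Longrightarrow> Some x \<in> U \<Longrightarrow> Some x \<noteq> z \<Longrightarrow> P x"
    by blast
  have "eventually (\<lambda>y. \<forall>x. y = Some x \<longrightarrow> P x) (atin_within extended_space z (Some ` V))"
    unfolding eventually_atin_within using U by blast
  then show "eventually P (approach V z)"
    unfolding approach_def eventually_filtercomap by blast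
qed

text \<open>The inclusion that follows from continuity of the extended inversion, applied also to the inverted
  domain, is an equality.\<close>

lemma filtermap_inversion_approach:
  fixes V :: "(real^'n) set"
  assumes "0 \<notin> V"
  shows "filtermap inversion (approach V z) = approach (inversion ` V) (extended_inversion z)"
proof -
  have transfer: "eventually (\<lambda>x. P (inversion x)) (approach V z)"
    if "0 \<notin> V" and P: "eventually P (approach (inversion ` V) (extended_inversion z))"
    for V :: "(real^'n) set" and z P
  proof -
    obtain U where U: "openin extended_space U" "extended_inversion z \<in> U"
      "\<And>\<xi>. \<xi> \<in> inversion ` V \<Longrightarrow> Some \<xi> \<in> U \<Longrightarrow> Some \<xi> \<noteq> extended_inversion z \<Longrightarrow> P \<xi>"
      using P unfolding eventually_approach_iff by blast
    have "P (inversion x)" if x: "x \<in> V" "Some x \<in> extended_inversion -` U" "Some x \<noteq> z" for x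
    proof (rule U(3))
      have eq: "extended_inversion (Some x) = Some (inversion x)"
        by (rule extended_inversion_Some[OF x(1) \<open>0 \<notin> V\<close>])
      show "inversion x \<in> inversion ` V" using x(1) by blast
      show "Some (inversion x) \<in> U" using x(2) by (simp only: vimage_eq eq)
      show "Some (inversion x) \<noteq> extended_inversion z"
        using x(3) unfolding eq[symmetric] extended_inversion_eq_iff .
    qed
    then show ?thesis
      unfolding eventually_approach_iff
      using openin_extended_inversion_vimage[OF U(1)] U(2) by blast
  qed
  show ?thesis
  proof (rule filter_eqI)
    fix P
    have "eventually (\<lambda>x. P (inversion x)) (approach V z) \<longleftrightarrow>
        eventually P (approach (inversion ` V) (extended_inversion z))"
    proof
      assume "eventually (\<lambda>x. P (inversion x)) (approach V z)"
      then show "eventually P (approach (inversion ` V) (extended_inversion z))"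
        using transfer[of "inversion ` V" "\<lambda>x. P (inversion x)" "extended_inversion z"] assms by simp
    qed (rule transfer[OF assms])
    then show "eventually P (filtermap inversion (approach V z)) \<longleftrightarrow>
        eventually P (approach (inversion ` V) (extended_inversion z))"
      by (simp only: eventually_filtermap)
  qed
qed

lemma Liminf_comp_inversion:
  fixes V :: "(real^'n) set" and u :: "real^'n \<Rightarrow> ereal"
  assumes "0 \<notin> V"
  shows "Liminf (approach (inversion ` V) (extended_inversion z)) (\<lambda>\<xi>. u (inversion \<xi>)) = Liminf (approach V z) u"
proof -
  have "Liminf (filtermap inversion (approach V z)) (\<lambda>\<xi>. u (inversion \<xi>)) =
      Liminf (approach V z) (\<lambda>x. u (inversion (inversion x)))"
    by (intro antisym Liminf_filtermap_le Liminf_filtermap_ge inj_inversion)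
  then show ?thesis by (simp add: filtermap_inversion_approach[OF assms])
qed

section \<open>Superharmonic functions, Perron solutions and regularity\<close>

lemma lower_semicontinuous_on_comp_inversion:
  fixes V :: "(real^'n) set"
  assumes "lower_semicontinuous_on V u" "0 \<notin> V"
  shows "lower_semicontinuous_on (inversion ` V) (\<lambda>\<xi>. u (inversion \<xi>))"
  unfolding lower_semicontinuous_on_def
proof
  fix a
  have cont: "continuous_on (inversion ` V) inversion"
    using assms(2) by (intro continuous_on_inversion) auto
  have "openin (top_of_set (inversion ` V)) (inversion ` V \<inter> inversion -` {x \<in> V. a < u x})"
    using assms(1) by (intro continuous_openin_preimage[OF cont, where T = V]) (auto simp: lower_semicontinuous_on_def)
  moreover have "inversion ` V \<inter> inversion -` {x \<in> V. a < u x} = {\<xi> \<in> inversion ` V. a < u (inversion \<xi>)}"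
    by (auto simp: mem_inversion_image_iff)
  ultimately show "openin (top_of_set (inversion ` V)) {\<xi> \<in> inversion ` V. a < u (inversion \<xi>)}"
    by simp
qed

text \<open>Each clause of the definition is transported: semicontinuity by continuity of the inversion, finiteness
  by the correspondence of components, and comparison by that of compactly contained sets, of their
  boundaries, and of the functions that are harmonic there.\<close>

lemma C_superharmonic_comp_inversion:
  fixes V :: "(real^'n) set"
  assumes "0 < p" "0 \<notin> V" and pair: "inversion_pair p \<omega> C \<omega>' C'" and u: "C_superharmonic p \<omega> C V u"
  shows "C_superharmonic p \<omega>' C' (inversion ` V) (\<lambda>\<xi>. u (inversion \<xi>))"
  unfolding C_superharmonic_def
proof (intro conjI ballI allI impI, goal_cases)
  case (1 \<xi>)
  then show ?case using u by (simp add: C_superharmonic_def mem_inversion_image_iff)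
next
  case 2
  show ?case
    using u by (intro lower_semicontinuous_on_comp_inversion assms(2)) (simp add: C_superharmonic_def)
next
  case (3 K)
  obtain L where L: "L \<in> components V" "inversion ` L \<subseteq> K"
    by (rule component_inversion_image[OF 3 assms(2)])
  obtain x where "x \<in> L" "u x \<noteq> \<infinity>"
    using u L(1) by (auto simp: C_superharmonic_def)
  then show ?case using L(2) by (intro bexI[of _ "inversion x"]) auto
next
  case (4 G v \<xi>)
  then have G: "open G" "compactly_contained G (inversion ` V)" and cont: "continuous_on (closure G) v"
    and harm: "C_harmonic p \<omega>' C' G v" and le: "\<And>\<xi>. \<xi> \<in> frontier G \<Longrightarrow> ereal (v \<xi>) \<le> u (inversion \<xi>)"
    by blast+
  note * = inversion_image_compactly_contained[OF G assms(2)]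
  have K: "compact (closure G)" "0 \<notin> closure G"
    using G(2) assms(2) by (auto simp: compactly_contained_def)
  \<comment> \<open>A comparison function on \<open>G\<close> becomes one for \<open>u\<close> on the inverted set, by the symmetry of the pair.\<close>
  have "C_harmonic p \<omega> C (inversion ` G) (\<lambda>x. v (inversion x))"
    using *(3) by (intro C_harmonic_comp_inversion[OF assms(1) _ inversion_pair_sym[OF pair] harm]) simp
  moreover have "continuous_on (closure (inversion ` G)) (\<lambda>x. v (inversion x))"
    unfolding closure_inversion_image[OF K] by (rule continuous_on_comp_inversion[OF cont K(2)])
  moreover have "\<forall>x\<in>frontier (inversion ` G). ereal (v (inversion x)) \<le> u x"
    unfolding frontier_inversion_image[OF G(1) K] using le by simp
  ultimately have "\<forall>x\<in>inversion ` G. ereal (v (inversion x)) \<le> u x"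
    using u *(1,2) unfolding C_superharmonic_def by blast
  then have "ereal (v (inversion (inversion \<xi>))) \<le> u (inversion \<xi>)"
    by (rule bspec) (use 4 in blast)
  then show ?case by simp
qed

lemma upper_class_comp_inversion:
  fixes V :: "(real^'n) set"
  assumes "0 < p" "open V" "0 \<notin> V" "inversion_pair p \<omega> C \<omega>' C'" "u \<in> upper_class p \<omega> C V f"
  shows "(\<lambda>\<xi>. u (inversion \<xi>)) \<in> upper_class p \<omega>' C' (inversion ` V) (\<lambda>z. f (extended_inversion z))"
proof -
  have u: "C_superharmonic p \<omega> C V u" "\<And>z. z \<in> extended_boundary V \<Longrightarrow> ereal (f z) \<le> Liminf (approach V z) u"
    using assms(5) by (auto simp: upper_class_def)
  have "ereal (f (extended_inversion z)) \<le> Liminf (approach (inversion ` V) z) (\<lambda>\<xi>. u (inversion \<xi>))"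
    if "z \<in> extended_boundary (inversion ` V)" for z
  proof -
    have "extended_inversion z \<in> extended_boundary (inversion ` inversion ` V)"
      using that assms(3)
      by (intro extended_inversion_mem_extended_boundary open_inversion_image assms(2)) simp_all
    then have "ereal (f (extended_inversion z)) \<le> Liminf (approach V (extended_inversion z)) u"
      by (intro u(2)) simp
    then show ?thesis
      using Liminf_comp_inversion[OF assms(3), of "extended_inversion z" u] by simp
  qed
  with C_superharmonic_comp_inversion[OF assms(1,3,4) u(1)] show ?thesis
    by (simp add: upper_class_def)
qed

lemma upper_Perron_comp_inversion:
  fixes V :: "(real^'n) set"
  assumes "0 < p" "open V" "0 \<notin> V" and pair: "inversion_pair p \<omega> C \<omega>' C'"
  shows "upper_Perron p \<omega>' C' (inversion ` V) (\<lambda>z. f (extended_inversion z)) (inversion x) =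
    upper_Perron p \<omega> C V f x"
proof -
  have le: "upper_Perron p \<omega>' C' (inversion ` V) (\<lambda>z. f (extended_inversion z)) (inversion x) \<le>
      upper_Perron p \<omega> C V f x"
    if "open V" "0 \<notin> V" "inversion_pair p \<omega> C \<omega>' C'" for V :: "(real^'n) set" and \<omega> C \<omega>' C' f x
    unfolding upper_Perron_def[of _ \<omega>]
  proof (rule INF_greatest)
    fix u assume "u \<in> upper_class p \<omega> C V f"
    from INF_lower[OF upper_class_comp_inversion[OF assms(1) that this], of "\<lambda>u. u (inversion x)"]
    show "upper_Perron p \<omega>' C' (inversion ` V) (\<lambda>z. f (extended_inversion z)) (inversion x) \<le> u x"
      by (simp add: upper_Perron_def)
  qed
  \<comment> \<open>The reverse inequality is the same one for the inverted data, since the inversion is an involution.\<close>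
  have "upper_Perron p \<omega> C V f x \<le>
      upper_Perron p \<omega>' C' (inversion ` V) (\<lambda>z. f (extended_inversion z)) (inversion x)"
    using le[of "inversion ` V" \<omega>' C' \<omega> C "\<lambda>z. f (extended_inversion z)" "inversion x"]
      open_inversion_image[OF assms(2,3)] assms(3) inversion_pair_sym[OF pair] by simp
  then show ?thesis by (rule antisym[OF le[OF assms(2-4)]])
qed

lemma continuous_boundary_data_comp_inversion:
  fixes V :: "(real^'n) set"
  assumes "open V" "0 \<notin> V" "f \<in> continuous_boundary_data (inversion ` V)"
  shows "(\<lambda>z. f (extended_inversion z)) \<in> continuous_boundary_data V"
proof -
  let ?X = "subtopology extended_space (extended_boundary V)"
  let ?Y = "subtopology extended_space (extended_boundary (inversion ` V))"
  have "continuous_map ?X ?Y extended_inversion"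
    by (intro continuous_map_into_subtopology continuous_map_from_subtopology
        continuous_map_extended_inversion Pi_I extended_inversion_mem_extended_boundary[OF assms(1,2)]) simp
  then have "continuous_map ?X euclidean (f \<circ> extended_inversion)"
    using assms(3) by (intro continuous_map_compose) (simp_all add: continuous_boundary_data_def)
  then show ?thesis by (simp add: continuous_boundary_data_def comp_def)
qed

text \<open>Composition with the inversion identifies the boundary data, the upper Perron solutions, and the
  filters along which the limit is taken.\<close>

lemma C_regular_inversion:
  fixes V :: "(real^'n) set"
  assumes "0 < p" "open V" "0 \<notin> V" "inversion_pair p \<omega> C \<omega>' C'" "C_regular p \<omega> C V z"
  shows "C_regular p \<omega>' C' (inversion ` V) (extended_inversion z)"
  unfolding C_regular_def
proof
  fix g :: "(real^'n) option \<Rightarrow> real" assume "g \<in> continuous_boundary_data (inversion ` V)"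
  then have "(\<lambda>z. g (extended_inversion z)) \<in> continuous_boundary_data V"
    by (rule continuous_boundary_data_comp_inversion[OF assms(2,3)])
  then have "(upper_Perron p \<omega> C V (\<lambda>z. g (extended_inversion z)) \<longlongrightarrow> ereal (g (extended_inversion z))) (approach V z)"
    using assms(5) unfolding C_regular_def by blast
  moreover have "upper_Perron p \<omega> C V (\<lambda>z. g (extended_inversion z)) =
      (\<lambda>x. upper_Perron p \<omega>' C' (inversion ` V) g (inversion x))"
    using upper_Perron_comp_inversion[OF assms(1-4), of "\<lambda>z. g (extended_inversion z)"]
    by (simp add: fun_eq_iff)
  ultimately show "(upper_Perron p \<omega>' C' (inversion ` V) g \<longlongrightarrow> ereal (g (extended_inversion z)))
      (approach (inversion ` V) (extended_inversion z))"
    by (simp only: filterlim_filtermap flip: filtermap_inversion_approach[OF assms(3)])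
qed

theorem theorem4p7:
  fixes p :: real
    and A :: "real^'n \<Rightarrow> real^'n \<Rightarrow> real^'n"
    and \<Omega> :: "(real^'n) set"
    and x\<^sub>0 :: "(real^'n) option"
  assumes "2 \<le> CARD('n)" and "real CARD('n) \<le> p"
    and "admissible_map p (\<lambda>_. 1) A"
    and "open \<Omega>" and "0 \<notin> \<Omega>" and "\<not> bounded \<Omega>"
    and "x\<^sub>0 \<in> extended_boundary \<Omega>"
  shows "extended_inversion x\<^sub>0 \<in> extended_boundary (inversion ` \<Omega>) \<and>
    (C_regular p (\<lambda>_. 1) A \<Omega> x\<^sub>0 \<longleftrightarrow>
     C_regular p (inversion_weight p) (transformed_map A) (inversion ` \<Omega>) (extended_inversion x\<^sub>0))"
proof (intro conjI iffI)
  have p: "0 < p" using assms(1,2) by linarith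
  have pair: "inversion_pair p (\<lambda>_. 1) A (inversion_weight p) (transformed_map A)"
    by (simp add: inversion_pair_def inversion_weights_def inversion_weight_def)
  show "extended_inversion x\<^sub>0 \<in> extended_boundary (inversion ` \<Omega>)"
    by (rule extended_inversion_mem_extended_boundary[OF assms(4,5,7)])
  show "C_regular p (inversion_weight p) (transformed_map A) (inversion ` \<Omega>) (extended_inversion x\<^sub>0)"
    if "C_regular p (\<lambda>_. 1) A \<Omega> x\<^sub>0"
    by (rule C_regular_inversion[OF p assms(4,5) pair that])
  show "C_regular p (\<lambda>_. 1) A \<Omega> x\<^sub>0"
    if "C_regular p (inversion_weight p) (transformed_map A) (inversion ` \<Omega>) (extended_inversion x\<^sub>0)"
    using C_regular_inversion[OF p open_inversion_image[OF assms(4,5)] _ inversion_pair_sym[OF pair] that]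
      assms(5) by simp
qed

end
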